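(* Let $\mathbb{Z}\mathbb{D}$ be the Fraïssé limit of the class of finite diversities whose diversity map takes only integral values. Then $\mathrm{Aut}(\mathbb{Z}\mathbb{D})$ is dissociated.
   Context: For a set $X$, $\mathcal{P}_{\mathrm{fin}}(X)$ is the set of finite subsets of $X$. A diversity is a couple $(X,\delta)$ where $\delta:\mathcal{P}_{\mathrm{fin}}(X)\to\mathbb{R}_+$ (the diversity map) satisfies: $\delta(A)=0$ if and only if $|A|\leq1$; and if $B\neq\emptyset$ then $\delta(A\cup C)\leq\delta(A\cup B)+\delta(B\cup C)$. Embeddings of diversities are injections preserving $\delta$ on all finite subsets. The class of finite diversities with integer-valued diversity map is a Fraïssé class; its Fraïssé limit $\mathbb{Z}\mathbb{D}$ is the unique (up to isomorphism) countable diversity with integer-valued diversity map into which every finite integer-valued diversity embeds and such that every isomorphism between finite sub-diversities extends to an automorphism. Let $\Omega$ be the countably infinite underlying set of $\mathbb{Z}\mathbb{D}$. $G=\mathrm{Aut}(\mathbb{Z}\mathbb{D})$ is the group of bijections of $\Omega$ preserving $\delta$, a closed subgroup of $\mathrm{Sym}(\Omega)$ with the topology of pointwise convergence. For $A\subseteq\Omega$, $G_A$ is the pointwise stabilizer of $A$. A unitary representation of $G$ on a Hilbert space $\mathcal{H}$ is a homomorphism $\pi:G\to\mathcal{U}(\mathcal{H})$ with $g\mapsto\pi(g)\xi$ continuous for all $\xi$. It is dissociated if $p_Ap_B=p_{A\cap B}$ for all finite $A,B\subseteq\Omega$, where $p_A$ is the orthogonal projection onto $\mathcal{H}_A=\{\xi\in\mathcal{H}:\pi(g)\xi=\xi\text{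 for all }g\in G_A\}$. $G$ is dissociated if all of its unitary representations are dissociated. *)

theory Defs
  imports "HOL-Analysis.Analysis"
begin

section \<open>Diversities and the integral Fraisse limit\<close>

text \<open>
  A diversity map on \<open>X\<close> is represented by a total function on sets; only its values on
  \<open>Fpow X\<close>, the finite subsets of \<open>X\<close>, matter.
\<close>

definition diversity_on :: "'a set \<Rightarrow> ('a set \<Rightarrow> real) \<Rightarrow> bool" where
  "diversity_on X \<delta> \<longleftrightarrow>
     (\<forall>A\<in>Fpow X. 0 \<le> \<delta> A) \<and>
     (\<forall>A\<in>Fpow X. \<delta> A = 0 \<longleftrightarrow> card A \<le> 1) \<and>
     (\<forall>A\<in>Fpow X. \<forall>B\<in>Fpow X. \<forall>C\<in>Fpow X.
        B \<noteq> {} \<longrightarrow> \<delta> (A \<union> C) \<le> \<delta> (A \<union> B) + \<delta> (B \<union> C))"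

definition integral_diversity_on :: "'a set \<Rightarrow> ('a set \<Rightarrow> real) \<Rightarrow> bool" where
  "integral_diversity_on X \<delta> \<longleftrightarrow> diversity_on X \<delta> \<and> (\<forall>A\<in>Fpow X. \<delta> A \<in> \<int>)"

definition diversity_embedding ::
    "'a set \<Rightarrow> ('a set \<Rightarrow> real) \<Rightarrow> 'b set \<Rightarrow> ('b set \<Rightarrow> real) \<Rightarrow> ('a \<Rightarrow> 'b) \<Rightarrow> bool" where
  "diversity_embedding X d Y e f \<longleftrightarrow>
     f ` X \<subseteq> Y \<and> inj_on f X \<and> (\<forall>A\<in>Fpow X. e (f ` A) = d A)"

definition diversity_iso ::
    "'a set \<Rightarrow> ('a set \<Rightarrow> real) \<Rightarrow> 'b set \<Rightarrow> ('b set \<Rightarrow> real) \<Rightarrow> ('a \<Rightarrow> 'b) \<Rightarrow> bool" where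
  "diversity_iso X d Y e f \<longleftrightarrow> diversity_embedding X d Y e f \<and> f ` X = Y"

definition diversity_Aut :: "('a set \<Rightarrow> real) \<Rightarrow> ('a \<Rightarrow> 'a) set" where
  "diversity_Aut \<delta> = {g. diversity_iso UNIV \<delta> UNIV \<delta> g}"

text \<open>
  The underlying set of the limit is the whole type \<open>'a\<close>.  The finite diversities that have to embed
  are taken on finite sets of natural numbers: every finite diversity is isomorphic to such a one.
\<close>

definition integral_Fraisse_limit :: "('a set \<Rightarrow> real) \<Rightarrow> bool" where
  "integral_Fraisse_limit \<delta> \<longleftrightarrow>
     countable (UNIV :: 'a set) \<and>
     integral_diversity_on UNIV \<delta> \<and>
     (\<forall>(X :: nat set) d. finite X \<and> integral_diversity_on X d \<longrightarrow>
        (\<exists>f. diversity_embedding X d UNIV \<delta> f)) \<and>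
     (\<forall>A B f. finite A \<and> finite B \<and> diversity_iso A \<delta> B \<delta> f \<longrightarrow>
        (\<exists>g\<in>diversity_Aut \<delta>. \<forall>x\<in>A. g x = f x))"


section \<open>Complex Hilbert spaces\<close>

text \<open>
  Complex inner product spaces sit on top of \<^class>\<open>real_inner\<close>, whose inner product is the real part
  of the complex one.  Hence positive definiteness and the identity
  \<open>norm x = sqrt (Re (cinner x x))\<close> are inherited.  The form is linear in its first argument.
\<close>

class complex_inner = real_inner +
  fixes scaleC :: "complex \<Rightarrow> 'a \<Rightarrow> 'a"  (infixr "*\<^sub>C" 75)
    and cinner :: "'a \<Rightarrow> 'a \<Rightarrow> complex"
  assumes scaleC_add_right: "c *\<^sub>C (x + y) = c *\<^sub>C x + c *\<^sub>C y"
    and scaleC_add_left: "(c + d) *\<^sub>C x = c *\<^sub>C x + d *\<^sub>C x"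
    and scaleC_scaleC: "c *\<^sub>C d *\<^sub>C x = (c * d) *\<^sub>C x"
    and scaleR_scaleC: "r *\<^sub>R x = complex_of_real r *\<^sub>C x"
    and cinner_commute: "cinner x y = cnj (cinner y x)"
    and cinner_add_left: "cinner (x + y) z = cinner x z + cinner y z"
    and cinner_scaleC_left: "cinner (c *\<^sub>C x) y = c * cinner x y"
    and inner_eq_Re_cinner: "x \<bullet> y = Re (cinner x y)"

class complex_hilbert_space = complex_inner + complete_space

instantiation complex :: complex_hilbert_space
begin

definition scaleC_complex :: "complex \<Rightarrow> complex \<Rightarrow> complex" where
  "scaleC_complex c x = c * x"

definition cinner_complex :: "complex \<Rightarrow> complex \<Rightarrow> complex" where
  "cinner_complex x y = x * cnj y"

instance
  by standard
    (auto simp: scaleC_complex_def cinner_complex_def algebra_simps scaleR_conv_of_real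
      inner_complex_def)

end

definition unitary :: "('h::complex_inner \<Rightarrow> 'h) \<Rightarrow> bool" where
  "unitary U \<longleftrightarrow>
     (\<forall>x y. U (x + y) = U x + U y) \<and> (\<forall>c x. U (c *\<^sub>C x) = c *\<^sub>C U x) \<and>
     surj U \<and> (\<forall>x y. cinner (U x) (U y) = cinner x y)"

text \<open>Well defined whenever \<open>S\<close> is a closed linear subspace of a Hilbert space.\<close>

definition orth_proj :: "'h::complex_inner set \<Rightarrow> 'h \<Rightarrow> 'h" where
  "orth_proj S x = (THE y. y \<in> S \<and> (\<forall>z\<in>S. cinner (x - y) z = 0))"


section \<open>Dissociated permutation groups\<close>

text \<open>
  Permutation groups are given as sets \<open>G\<close> of functions with composition as multiplication, carrying
  the topology of pointwise convergence, i.e. the one induced by the power of the discrete space.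
\<close>

definition pointwise_topology :: "('a \<Rightarrow> 'a) set \<Rightarrow> ('a \<Rightarrow> 'a) topology" where
  "pointwise_topology G = subtopology (product_topology (\<lambda>_. discrete_topology UNIV) UNIV) G"

definition pointwise_stabilizer :: "('a \<Rightarrow> 'a) set \<Rightarrow> 'a set \<Rightarrow> ('a \<Rightarrow> 'a) set" where
  "pointwise_stabilizer G A = {g\<in>G. \<forall>a\<in>A. g a = a}"

definition unitary_representation ::
    "('a \<Rightarrow> 'a) set \<Rightarrow> (('a \<Rightarrow> 'a) \<Rightarrow> 'h::complex_hilbert_space \<Rightarrow> 'h) \<Rightarrow> bool" where
  "unitary_representation G \<pi> \<longleftrightarrow>
     (\<forall>g\<in>G. unitary (\<pi> g)) \<and>
     (\<forall>g\<in>G. \<forall>h\<in>G. \<pi> (g \<circ> h) = \<pi> g \<circ> \<pi> h) \<and>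
     (\<forall>\<xi>. continuous_map (pointwise_topology G) euclidean (\<lambda>g. \<pi> g \<xi>))"

definition fixed_vectors ::
    "('a \<Rightarrow> 'a) set \<Rightarrow> (('a \<Rightarrow> 'a) \<Rightarrow> 'h::complex_hilbert_space \<Rightarrow> 'h) \<Rightarrow> 'a set \<Rightarrow> 'h set" where
  "fixed_vectors G \<pi> A = {\<xi>. \<forall>g\<in>pointwise_stabilizer G A. \<pi> g \<xi> = \<xi>}"

definition dissociated_representation ::
    "('a \<Rightarrow> 'a) set \<Rightarrow> (('a \<Rightarrow> 'a) \<Rightarrow> 'h::complex_hilbert_space \<Rightarrow> 'h) \<Rightarrow> bool" where
  "dissociated_representation G \<pi> \<longleftrightarrow>
     (\<forall>A B. finite A \<and> finite B \<longrightarrow>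
        orth_proj (fixed_vectors G \<pi> A) \<circ> orth_proj (fixed_vectors G \<pi> B) =
        orth_proj (fixed_vectors G \<pi> (A \<inter> B)))"

text \<open>
  HOL cannot quantify over types inside a definition, so the type of the Hilbert space is a
  parameter; a theorem with a type variable in this place speaks about all Hilbert spaces.
\<close>

definition dissociated_group ::
    "'h::complex_hilbert_space itself \<Rightarrow> ('a \<Rightarrow> 'a) set \<Rightarrow> bool" where
  "dissociated_group H G \<longleftrightarrow>
     (\<forall>\<pi> :: ('a \<Rightarrow> 'a) \<Rightarrow> 'h \<Rightarrow> 'h.
        unitary_representation G \<pi> \<longrightarrow> dissociated_representation G \<pi>)"

end

theory Submission
  imports Defs
begin

text \<open>
  Write \<open>H A\<close> for the vectors fixed by the pointwise stabilizer of \<open>A\<close>.  Dissociation says that the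
  part of a vector of \<open>H A\<close> which is visible in \<open>H B\<close> already lies in \<open>H (A \<inter> B)\<close>.  Removing the
  points of \<open>A - B\<close> from \<open>A\<close>, and adding the points of \<open>B - A\<close> to \<open>A \<inter> B\<close>, one at a time reduces
  this to \<open>A = C \<union> {a}\<close> and \<open>B = C \<union> {b}\<close> with \<open>a \<noteq> b\<close> outside the finite set \<open>C\<close>.

  A vector \<open>\<xi> \<in> H (C \<union> {a})\<close> has translates indexed by the points \<open>x\<close> in the orbit of \<open>a\<close> under the
  stabilizer of \<open>C\<close>, and by homogeneity the inner product of the translate at \<open>x\<close> with
  \<open>v \<in> H (C \<union> {b})\<close> depends only on the type of \<open>x\<close> over \<open>C \<union> {b}\<close>.  The heart of the matter is that,
  as long as \<open>x \<noteq> b\<close>, it does not even depend on this type (\<open>coefficient_constant\<close>).  Granted this, and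
  using it also with a point of the orbit in the role of \<open>b\<close>, the translates of \<open>\<xi>\<close> have constant norm
  and constant mutual inner products, so their means converge to a vector \<open>\<zeta>\<close> that does not
  depend on the chosen points of the orbit.  Hence \<open>\<zeta> \<in> H C\<close>, and \<open>\<zeta>\<close> has the same inner products as
  \<open>\<xi>\<close> with \<open>H (C \<union> {b})\<close> (\<open>one_point_dissociation\<close>).

  For the constancy, suppose that the limit contains points \<open>x\<^sub>0, x\<^sub>1, \<dots>\<close> of one type over
  \<open>C \<union> {b}\<close> and \<open>y\<^sub>0, y\<^sub>1, \<dots>\<close> of another one such that all pairs of distinct points among them have the
  same type over \<open>C\<close>.  Then the differences of the translates at \<open>x\<^sub>i\<close> and \<open>y\<^sub>i\<close> are orthogonal, of
  bounded norm, and have the same inner product with \<open>v\<close>, which therefore vanishes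
  (\<open>coefficient_eq_twins\<close>).  In an integral diversity such families are cheap to build whenever the
  two types are close, namely when the second arises from the first by raising some values \<open>k\<close>
  to \<open>k + 1\<close>: let all the new points be twins over \<open>C\<close>, as near to each other as the values over \<open>C\<close>
  permit.  This is a diversity because distinct points are at distance at least \<open>1\<close>, which makes up
  for the difference of \<open>1\<close> between the two types (\<open>integral_diversity_on_blowup\<close>).  Finally, if
  \<open>e \<le> f\<close> are two types, the clamped functions \<open>max e (min k f)\<close> for \<open>k = 0, 1, 2, \<dots>\<close> lead from \<open>e\<close>
  to \<open>f\<close> by such steps, and any two types lie below their pointwise maximum.

  Orthogonality to a complex subspace can be tested with the real inner product, so only the latter
  is used.
\<close>

section \<open>Hilbert space geometry\<close>

lemma Cauchy_if_norm_diff_squared_le: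
  fixes u :: "nat \<Rightarrow> 'h::real_inner"
  assumes "\<And>m n. (norm (u m - u n))\<^sup>2 \<le> c / real (Suc m) + c / real (Suc n)"
  shows "Cauchy u"
proof (rule metric_CauchyI)
  fix e :: real assume e: "0 < e"
  have c: "c \<ge> 0" using assms[of 0 0] by simp
  obtain N :: nat where N: "2 * c / e\<^sup>2 < real N" using reals_Archimedean2 by blast
  have "dist (u m) (u n) < e" if "m \<ge> N" "n \<ge> N" for m n
  proof -
    have le: "c / real (Suc k) \<le> c / real (Suc N)" if "k \<ge> N" for k
      using that c by (intro divide_left_mono) auto
    have "(norm (u m - u n))\<^sup>2 \<le> 2 * c / real (Suc N)"
      using assms[of m n] le[OF that(1)] le[OF that(2)] by simp
    also have "2 * c < e\<^sup>2 * real (Suc N)"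
    proof -
      have "2 * c < e\<^sup>2 * real N" using N e by (simp add: field_simps)
      also have "\<dots> \<le> e\<^sup>2 * real (Suc N)" by (intro mult_left_mono) auto
      finally show ?thesis .
    qed
    then have "2 * c / real (Suc N) < e\<^sup>2" by (simp add: field_simps)
    finally have "norm (u m - u n) < e"
      using e by (meson less_le_not_le not_le power_mono order.trans less_imp_le)
    then show ?thesis by (simp add: dist_norm)
  qed
  then show "\<exists>M. \<forall>m\<ge>M. \<forall>n\<ge>M. dist (u m) (u n) < e" by blast
qed

text \<open>
  A minimizing sequence for the distance is Cauchy by the parallelogram law, and its limit is the
  foot of the perpendicular.
\<close>

lemma orthogonal_projection_exists:
  fixes S :: "'h::{real_inner,complete_space} set"
  assumes S: "subspace S" and cl: "closed S"
  shows "\<exists>y\<in>S. \<forall>z\<in>S. (x - y) \<bullet> z = 0"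
proof -
  define D where "D = Inf ((\<lambda>y. (norm (x - y))\<^sup>2) ` S)"
  have ne: "S \<noteq> {}" using subspace_0[OF S] by blast
  have D_le: "D \<le> (norm (x - y))\<^sup>2" if "y \<in> S" for y
    unfolding D_def using that by (intro cInf_lower bdd_belowI2[where m = 0]) auto
  have "\<exists>y\<in>S. (norm (x - y))\<^sup>2 < D + 1 / real (Suc n)" for n
    using cInf_lessD[of "(\<lambda>y. (norm (x - y))\<^sup>2) ` S" "D + 1 / real (Suc n)"] ne
    by (auto simp flip: D_def)
  then obtain y where yS: "\<And>n. y n \<in> S" and y: "\<And>n. (norm (x - y n))\<^sup>2 < D + 1 / real (Suc n)"
    by metis
  have "(norm (y m - y n))\<^sup>2 \<le> 2 / real (Suc m) + 2 / real (Suc n)" for m n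
  proof -
    have "(1/2) *\<^sub>R (y m + y n) \<in> S" using yS S by (simp add: subspace_add subspace_scale)
    from D_le[OF this] have "4 * D \<le> 4 * (norm (x - (1/2) *\<^sub>R (y m + y n)))\<^sup>2" by simp
    moreover have "(norm (y m - y n))\<^sup>2 + 4 * (norm (x - (1/2) *\<^sub>R (y m + y n)))\<^sup>2
        = 2 * (norm (x - y m))\<^sup>2 + 2 * (norm (x - y n))\<^sup>2"
      by (simp add: power2_norm_eq_inner inner_simps inner_commute algebra_simps)
    ultimately show ?thesis using y[of m] y[of n] by simp
  qed
  then have "Cauchy y" by (rule Cauchy_if_norm_diff_squared_le)
  then obtain l where l: "y \<longlonglongrightarrow> l" using Cauchy_convergent convergent_def by blast
  have lS: "l \<in> S" using closed_sequentially[OF cl _ l] yS by blast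
  have "(\<lambda>n. (norm (x - y n))\<^sup>2) \<longlonglongrightarrow> (norm (x - l))\<^sup>2" by (intro tendsto_intros l)
  moreover have "(\<lambda>n. D + 1 / real (Suc n)) \<longlonglongrightarrow> D + 0"
    by (intro tendsto_intros LIMSEQ_Suc[OF lim_1_over_n])
  ultimately have lD: "(norm (x - l))\<^sup>2 \<le> D"
    using LIMSEQ_le[of _ _ "\<lambda>n. D + 1 / real (Suc n)" "D + 0"] y
    by (metis (no_types, lifting) add.right_neutral less_imp_le)
  have "(x - l) \<bullet> z = 0" if z: "z \<in> S" for z
  proof (cases "z = 0")
    case False
    \<comment> \<open>This step along \<open>z\<close> is the one that comes closest to \<open>x\<close>.\<close>
    define t where "t = ((x - l) \<bullet> z) / (z \<bullet> z)"
    have "l + t *\<^sub>R z \<in> S" using lS z S by (simp add: subspace_add subspace_scale)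
    with lD have "(norm (x - l))\<^sup>2 \<le> (norm (x - (l + t *\<^sub>R z)))\<^sup>2" using D_le order_trans by blast
    also have "x - (l + t *\<^sub>R z) = (x - l) - t *\<^sub>R z" by simp
    also have "(norm \<dots>)\<^sup>2 = (norm (x - l))\<^sup>2 - 2 * t * ((x - l) \<bullet> z) + t * t * (z \<bullet> z)"
      by (simp add: power2_norm_eq_inner inner_diff inner_commute algebra_simps)
    also have "t * t * (z \<bullet> z) = t * ((x - l) \<bullet> z)" using False by (simp add: t_def)
    finally have "t * ((x - l) \<bullet> z) \<le> 0" by simp
    then have "((x - l) \<bullet> z)\<^sup>2 / (z \<bullet> z) \<le> 0" by (simp add: t_def power2_eq_square)
    then have "((x - l) \<bullet> z)\<^sup>2 \<le> 0" using False inner_gt_zero_iff[of z]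
      by (simp add: divide_le_0_iff del: inner_gt_zero_iff)
    then show ?thesis by simp
  qed simp
  with lS show ?thesis by blast
qed

text \<open>
  The imaginary part of \<open>cinner x z\<close> is the real inner product of \<open>x\<close> with \<open>\<i> *\<^sub>C z\<close>, so real
  orthogonality to a subspace that is closed under multiplication by \<open>\<i>\<close> is complex orthogonality.
\<close>

lemma orth_proj_eqI:
  fixes S :: "'h::complex_hilbert_space set"
  assumes S: "subspace S" and cS: "\<And>z. z \<in> S \<Longrightarrow> \<i> *\<^sub>C z \<in> S"
    and y: "y \<in> S" and orth: "\<And>z. z \<in> S \<Longrightarrow> (x - y) \<bullet> z = 0"
  shows "orth_proj S x = y"
  unfolding orth_proj_def
proof (rule the_equality)
  show "y \<in> S \<and> (\<forall>z\<in>S. cinner (x - y) z = 0)"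
  proof (intro conjI ballI y)
    fix z assume z: "z \<in> S"
    have "cinner (x - y) (\<i> *\<^sub>C z) = - \<i> * cinner (x - y) z"
      by (metis cinner_commute cinner_scaleC_left complex_cnj_i complex_cnj_mult)
    then have "Im (cinner (x - y) z) = (x - y) \<bullet> (\<i> *\<^sub>C z)"
      by (simp add: inner_eq_Re_cinner)
    then show "cinner (x - y) z = 0"
      using orth[OF z] orth[OF cS[OF z]] by (simp add: complex_eq_iff flip: inner_eq_Re_cinner)
  qed
next
  fix y' assume y': "y' \<in> S \<and> (\<forall>z\<in>S. cinner (x - y') z = 0)"
  have d: "y' - y \<in> S" using y y' S by (simp add: subspace_diff)
  have "(x - y') \<bullet> (y' - y) = 0" using y' d by (simp add: inner_eq_Re_cinner)
  with orth[OF d] have "(y' - y) \<bullet> (y' - y) = 0" by (simp add: inner_diff)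
  then show "y' = y" by simp
qed

text \<open>
  The sum of \<open>N\<close> such vectors has inner product \<open>N * t\<close> with \<open>v\<close> but norm at most \<open>c * sqrt N\<close>, so the
  Cauchy--Schwarz inequality forces \<open>t = 0\<close>.
\<close>

lemma inner_eq_0_if_constant_on_orthogonal_families:
  fixes v :: "'h::real_inner"
  assumes "\<And>N::nat. \<exists>u::nat \<Rightarrow> 'h. (\<forall>i<N. u i \<bullet> v = t \<and> norm (u i) \<le> c) \<and>
              (\<forall>i<N. \<forall>j<N. i \<noteq> j \<longrightarrow> u i \<bullet> u j = 0)"
  shows "t = 0"
proof -
  have bound: "real N * t\<^sup>2 \<le> c\<^sup>2 * (norm v)\<^sup>2" for N
  proof (cases "N = 0")
    case False
    obtain u :: "nat \<Rightarrow> 'h" where u: "\<And>i. i < N \<Longrightarrow> u i \<bullet> v = t" "\<And>i. i < N \<Longrightarrow> norm (u i) \<le> c"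
      "\<And>i j. i < N \<Longrightarrow> j < N \<Longrightarrow> i \<noteq> j \<Longrightarrow> u i \<bullet> u j = 0"
      using assms[of N] by blast
    let ?s = "\<Sum>i<N. u i"
    have "?s \<bullet> ?s = (\<Sum>i<N. \<Sum>j<N. u i \<bullet> u j)"
      by (simp add: inner_sum_left inner_sum_right) (rule sum.swap)
    also have "\<dots> = (\<Sum>i<N. \<Sum>j<N. if j = i then u i \<bullet> u i else 0)"
      using u(3) by (intro sum.cong refl) auto
    also have "\<dots> = (\<Sum>i<N. u i \<bullet> u i)" by (simp add: sum.delta)
    also have "\<dots> \<le> (\<Sum>i<N. c\<^sup>2)"
      using u(2) by (intro sum_mono) (simp add: power_mono flip: power2_norm_eq_inner)
    finally have ss: "?s \<bullet> ?s \<le> real N * c\<^sup>2" by simp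
    have "?s \<bullet> v = (\<Sum>i<N. t)" unfolding inner_sum_left using u(1) by (intro sum.cong) auto
    then have "(real N * t)\<^sup>2 \<le> (?s \<bullet> ?s) * (v \<bullet> v)" using Cauchy_Schwarz_ineq[of ?s v] by simp
    also have "\<dots> \<le> (real N * c\<^sup>2) * (v \<bullet> v)" using ss by (intro mult_right_mono) auto
    finally have "real N * (real N * t\<^sup>2) \<le> real N * (c\<^sup>2 * (norm v)\<^sup>2)"
      by (simp add: power_mult_distrib power2_norm_eq_inner power2_eq_square[of "real N"] algebra_simps)
    then show ?thesis using False by simp
  qed simp
  show "t = 0"
  proof (rule ccontr)
    assume "t \<noteq> 0"
    then obtain N :: nat where "(c\<^sup>2 * (norm v)\<^sup>2) / t\<^sup>2 < real N" using reals_Archimedean2 by blast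
    with \<open>t \<noteq> 0\<close> have "c\<^sup>2 * (norm v)\<^sup>2 < real N * t\<^sup>2" by (simp add: field_simps)
    with bound[of N] show False by simp
  qed
qed

text \<open>
  The means of such vectors form a Cauchy sequence, because the mean of \<open>M\<close> of them and that of \<open>N \<ge> M\<close>
  have inner product \<open>k + (c - k) / N\<close>.  One exceptional index is harmless for the limit; it is
  needed to evaluate the limit against the vectors \<open>w n\<close> themselves.
\<close>

lemma equicorrelated_mean_limit:
  fixes w :: "nat \<Rightarrow> 'h::{real_inner,complete_space}"
  assumes nrm: "\<And>n. w n \<bullet> w n = c" and corr: "\<And>m n. m \<noteq> n \<Longrightarrow> w m \<bullet> w n = k"
  obtains z where "z \<bullet> z = k"
    and "\<And>v t n0. (\<And>n. n \<noteq> n0 \<Longrightarrow> w n \<bullet> v = t) \<Longrightarrow> z \<bullet> v = t"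
proof -
  define u where "u N = (1 / real (Suc N)) *\<^sub>R (\<Sum>n<Suc N. w n)" for N
  have gram: "(\<Sum>m<M. w m) \<bullet> (\<Sum>n<N. w n) = real M * real N * k + real (min M N) * (c - k)" for M N
  proof -
    have "(\<Sum>m<M. w m) \<bullet> (\<Sum>n<N. w n) = (\<Sum>m<M. \<Sum>n<N. w m \<bullet> w n)"
      by (simp add: inner_sum_left inner_sum_right) (rule sum.swap)
    also have "\<dots> = (\<Sum>m<M. \<Sum>n<N. k + (if n = m then c - k else 0))"
      using nrm corr by (intro sum.cong refl) auto
    also have "\<dots> = (\<Sum>m<M. real N * k + (if m < N then c - k else 0))"
      by (intro sum.cong refl) (simp add: sum.distrib sum.delta)
    also have "\<dots> = real M * real N * k + (\<Sum>m\<in>{..<M} \<inter> {m. m < N}. c - k)"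
      by (simp add: sum.distrib sum.If_cases)
    also have "{..<M} \<inter> {m. m < N} = {..<min M N}" by auto
    finally show ?thesis by simp
  qed
  have uu: "u M \<bullet> u N = k + (c - k) * real (Suc (min M N)) / (real (Suc M) * real (Suc N))" for M N
    unfolding u_def inner_scaleR_left inner_scaleR_right gram
    by (simp add: field_simps del: of_nat_Suc)
  have ck: "c - k \<ge> 0"
  proof -
    have "0 \<le> (w 0 - w 1) \<bullet> (w 0 - w 1)" by simp
    also have "\<dots> = 2 * (c - k)" using nrm corr by (simp add: inner_diff)
    finally show ?thesis by simp
  qed
  have "(norm (u M - u N))\<^sup>2 \<le> (c - k) / real (Suc M) + (c - k) / real (Suc N)" for M N
  proof -
    have "(norm (u M - u N))\<^sup>2 = u M \<bullet> u M + u N \<bullet> u N - 2 * (u M \<bullet> u N)"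
      by (simp add: power2_norm_eq_inner inner_diff inner_commute)
    also have "\<dots> = (c - k) / real (Suc M) + (c - k) / real (Suc N)
        - 2 * ((c - k) * real (Suc (min M N)) / (real (Suc M) * real (Suc N)))"
      unfolding uu by (simp add: divide_simps del: of_nat_Suc) (simp add: algebra_simps del: of_nat_Suc)
    also have "\<dots> \<le> (c - k) / real (Suc M) + (c - k) / real (Suc N)" using ck by simp
    finally show ?thesis .
  qed
  then have "Cauchy u" by (rule Cauchy_if_norm_diff_squared_le)
  then obtain z where z: "u \<longlonglongrightarrow> z" using Cauchy_convergent convergent_def by blast
  have weak: "z \<bullet> v = t" if v: "\<And>n. n \<noteq> n0 \<Longrightarrow> w n \<bullet> v = t" for v t n0
  proof -
    have bound: "norm (u N \<bullet> v - t) \<le> \<bar>w n0 \<bullet> v - t\<bar> * (1 / real (Suc N))" for N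
    proof -
      have "u N \<bullet> v - t = (1 / real (Suc N)) * (\<Sum>n<Suc N. w n \<bullet> v - t)"
        by (simp add: u_def inner_sum_left sum_subtractf right_diff_distrib del: of_nat_Suc sum.lessThan_Suc)
      also have "(\<Sum>n<Suc N. w n \<bullet> v - t) = (\<Sum>n<Suc N. if n = n0 then w n0 \<bullet> v - t else 0)"
        using v by (intro sum.cong refl) auto
      also have "\<bar>1 / real (Suc N) * \<dots>\<bar> \<le> \<bar>w n0 \<bullet> v - t\<bar> * (1 / real (Suc N))"
        by (simp add: sum.delta abs_mult del: sum.lessThan_Suc)
      finally show ?thesis by simp
    qed
    have "(\<lambda>N. \<bar>w n0 \<bullet> v - t\<bar> * (1 / real (Suc N))) \<longlonglongrightarrow> 0"
      by (rule tendsto_mult_right_zero[OF LIMSEQ_Suc[OF lim_1_over_n]])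
    from Lim_null_comparison[OF always_eventually this]
    have "(\<lambda>N. u N \<bullet> v - t) \<longlonglongrightarrow> 0" by this (rule allI, rule bound)
    moreover have "(\<lambda>N. u N \<bullet> v - t) \<longlonglongrightarrow> z \<bullet> v - t" by (intro tendsto_intros z)
    ultimately have "z \<bullet> v - t = 0" by (rule LIMSEQ_unique[rotated])
    then show ?thesis by simp
  qed
  have "w m \<bullet> z = k" for m using weak[of m "w m" k] corr by (simp add: inner_commute)
  then have "z \<bullet> z = k" using weak[of 0 z k] by simp
  then show ?thesis using weak by (rule that)
qed

section \<open>Integral diversities\<close>

text \<open>
  Adding a single point to \<open>A\<close> does not decrease \<open>d\<close>, by the triangle inequality through that point and
  the empty set; so \<open>d\<close> is monotone.  For monotone functions the triangle inequality is subadditivity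
  on sets that meet, a form that is easier to check for newly built diversities.
\<close>

lemma diversity_on_iff:
  "diversity_on X d \<longleftrightarrow>
     (\<forall>A\<in>Fpow X. 0 \<le> d A \<and> (d A = 0 \<longleftrightarrow> card A \<le> 1)) \<and>
     (\<forall>B\<in>Fpow X. \<forall>A. A \<subseteq> B \<longrightarrow> d A \<le> d B) \<and>
     (\<forall>A\<in>Fpow X. \<forall>B\<in>Fpow X. A \<inter> B \<noteq> {} \<longrightarrow> d (A \<union> B) \<le> d A + d B)"
  (is "_ \<longleftrightarrow> ?nonneg \<and> ?mono \<and> ?subadd")
proof
  assume d: "diversity_on X d"
  then have tri: "d (A \<union> C) \<le> d (A \<union> B) + d (B \<union> C)"
    if "A \<in> Fpow X" "B \<in> Fpow X" "C \<in> Fpow X" "B \<noteq> {}" for A B C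
    using that by (simp add: diversity_on_def)
  have nonneg: ?nonneg using d by (auto simp: diversity_on_def)
  have insert_mono: "d A \<le> d (insert x A)" if "insert x A \<in> Fpow X" for x A
  proof -
    have "A \<in> Fpow X" "{x} \<in> Fpow X" "{} \<in> Fpow X" using that by (auto simp: Fpow_def)
    moreover from this have "d {x} = 0" using nonneg by simp
    ultimately show ?thesis using tri[of A "{x}" "{}"] by simp
  qed
  have ?mono
  proof (intro ballI allI impI)
    fix A B assume B: "B \<in> Fpow X" "A \<subseteq> B"
    have "d A \<le> d (A \<union> F)" if "finite F" "A \<union> F \<in> Fpow X" for F
      using that
    proof (induction F rule: finite_induct)
      case (insert x F)
      then have "d A \<le> d (A \<union> F)" by (simp add: Fpow_def)
      also have "\<dots> \<le> d (A \<union> insert x F)"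
        using insert_mono[of x "A \<union> F"] insert.prems by simp
      finally show ?case .
    qed simp
    from this[of "B - A"] B show "d A \<le> d B" by (simp add: Fpow_def Un_absorb1)
  qed
  moreover have ?subadd
  proof (intro ballI impI)
    fix A B assume AB: "A \<in> Fpow X" "B \<in> Fpow X" "A \<inter> B \<noteq> {}"
    then obtain c where c: "c \<in> A" "c \<in> B" by blast
    then have "{c} \<in> Fpow X" "A \<union> {c} = A" "{c} \<union> B = B" using AB by (auto simp: Fpow_def)
    then show "d (A \<union> B) \<le> d A + d B" using tri[of A "{c}" B] AB by simp
  qed
  ultimately show "?nonneg \<and> ?mono \<and> ?subadd" using nonneg by blast
next
  assume d: "?nonneg \<and> ?mono \<and> ?subadd"
  then have mono: "d A \<le> d B" if "B \<in> Fpow X" "A \<subseteq> B" for A B using that by simp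
  have "d (A \<union> C) \<le> d (A \<union> B) + d (B \<union> C)"
    if ABC: "A \<in> Fpow X" "B \<in> Fpow X" "C \<in> Fpow X" "B \<noteq> {}" for A B C
  proof -
    have "(A \<union> B) \<union> (B \<union> C) \<in> Fpow X" using ABC by (auto simp: Fpow_def)
    then have "d (A \<union> C) \<le> d ((A \<union> B) \<union> (B \<union> C))" by (rule mono) auto
    also have "A \<union> B \<in> Fpow X" "B \<union> C \<in> Fpow X" "(A \<union> B) \<inter> (B \<union> C) \<noteq> {}"
      using ABC by (auto simp: Fpow_def)
    then have "d ((A \<union> B) \<union> (B \<union> C)) \<le> d (A \<union> B) + d (B \<union> C)" using d by simp
    finally show ?thesis .
  qed
  with d show "diversity_on X d" by (auto simp: diversity_on_def)
qed

lemma integral_diversity_onI: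
  assumes "\<And>A. A \<in> Fpow X \<Longrightarrow> d A \<in> \<int>"
    and "\<And>A. A \<in> Fpow X \<Longrightarrow> card A \<le> 1 \<Longrightarrow> d A = 0"
    and "\<And>A. A \<in> Fpow X \<Longrightarrow> 2 \<le> card A \<Longrightarrow> 1 \<le> d A"
    and "\<And>A B. B \<in> Fpow X \<Longrightarrow> A \<subseteq> B \<Longrightarrow> d A \<le> d B"
    and "\<And>A B. A \<in> Fpow X \<Longrightarrow> B \<in> Fpow X \<Longrightarrow> A \<inter> B \<noteq> {} \<Longrightarrow> d (A \<union> B) \<le> d A + d B"
  shows "integral_diversity_on X d"
proof -
  have "0 \<le> d A \<and> (d A = 0 \<longleftrightarrow> card A \<le> 1)" if "A \<in> Fpow X" for A
    using assms(2,3)[OF that] by fastforce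
  then show ?thesis using assms(1,4,5) by (simp add: integral_diversity_on_def diversity_on_iff)
qed

lemma integral_diversity_onD:
  assumes "integral_diversity_on X d" "A \<in> Fpow X"
  shows "d A \<in> \<int>" and "0 \<le> d A" and "card A \<le> 1 \<Longrightarrow> d A = 0" and "2 \<le> card A \<Longrightarrow> 1 \<le> d A"
    and "B \<subseteq> A \<Longrightarrow> d B \<le> d A"
    and "B \<in> Fpow X \<Longrightarrow> A \<inter> B \<noteq> {} \<Longrightarrow> d (A \<union> B) \<le> d A + d B"
proof -
  show int: "d A \<in> \<int>" using assms by (simp add: integral_diversity_on_def)
  show nonneg: "0 \<le> d A" and "card A \<le> 1 \<Longrightarrow> d A = 0" and "B \<subseteq> A \<Longrightarrow> d B \<le> d A"
    and "B \<in> Fpow X \<Longrightarrow> A \<inter> B \<noteq> {} \<Longrightarrow> d (A \<union> B) \<le> d A + d B"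
    using assms by (auto simp: integral_diversity_on_def diversity_on_iff)
  assume "2 \<le> card A"
  then have "d A \<noteq> 0" using assms by (auto simp: integral_diversity_on_def diversity_on_iff)
  with int nonneg show "1 \<le> d A" by (auto simp: Ints_def)
qed

lemma integral_diversity_on_max:
  assumes d: "integral_diversity_on X d" and e: "integral_diversity_on X e"
  shows "integral_diversity_on X (\<lambda>A. max (d A) (e A))"
proof (rule integral_diversity_onI)
  fix A B assume AB: "A \<in> Fpow X" "B \<in> Fpow X" "A \<inter> B \<noteq> {}"
  show "max (d (A \<union> B)) (e (A \<union> B)) \<le> max (d A) (e A) + max (d B) (e B)"
    using integral_diversity_onD(6)[OF d AB] integral_diversity_onD(6)[OF e AB] by linarith
next
  fix A B assume B: "B \<in> Fpow X" "A \<subseteq> B"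
  show "max (d A) (e A) \<le> max (d B) (e B)"
    using integral_diversity_onD(5)[OF d B] integral_diversity_onD(5)[OF e B] by linarith
qed (use integral_diversity_onD[OF d] integral_diversity_onD[OF e] in \<open>auto simp: max_def\<close>)

text \<open>
  Truncating \<open>e\<close> at a level alone could destroy positivity (at level \<open>0\<close>), which the maximum with \<open>d\<close>
  restores.  Along \<open>k = 0, 1, 2, \<dots>\<close> these functions interpolate between \<open>d\<close> and \<open>max d e\<close>.
\<close>

lemma integral_diversity_on_clamp:
  assumes d: "integral_diversity_on X d" and e: "integral_diversity_on X e"
  shows "integral_diversity_on X (\<lambda>A. max (d A) (min (real k) (e A)))"
proof (rule integral_diversity_onI)
  fix A B assume AB: "A \<in> Fpow X" "B \<in> Fpow X" "A \<inter> B \<noteq> {}"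
  show "max (d (A \<union> B)) (min (real k) (e (A \<union> B)))
      \<le> max (d A) (min (real k) (e A)) + max (d B) (min (real k) (e B))"
    using integral_diversity_onD(6)[OF d AB] integral_diversity_onD(6)[OF e AB]
      integral_diversity_onD(2)[OF e AB(1)] integral_diversity_onD(2)[OF e AB(2)] by linarith
next
  fix A B assume B: "B \<in> Fpow X" "A \<subseteq> B"
  show "max (d A) (min (real k) (e A)) \<le> max (d B) (min (real k) (e B))"
    using integral_diversity_onD(5)[OF d B] integral_diversity_onD(5)[OF e B] by linarith
next
  fix A assume A: "A \<in> Fpow X" "card A \<le> 1"
  then show "max (d A) (min (real k) (e A)) = 0"
    using integral_diversity_onD(3)[OF d A] integral_diversity_onD(3)[OF e A] by simp
next
  fix A assume A: "A \<in> Fpow X" "2 \<le> card A"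
  then show "1 \<le> max (d A) (min (real k) (e A))" using integral_diversity_onD(4)[OF d A] by simp
next
  fix A assume A: "A \<in> Fpow X"
  then show "max (d A) (min (real k) (e A)) \<in> \<int>"
    using integral_diversity_onD(1)[OF d A] integral_diversity_onD(1)[OF e A]
    by (simp add: max_def min_def)
qed

lemma integral_diversity_on_pullback:
  assumes d: "integral_diversity_on Y d" and f: "inj_on f X" "f ` X \<subseteq> Y"
  shows "integral_diversity_on X (\<lambda>A. d (f ` A))"
proof -
  have im: "f ` A \<in> Fpow Y" "card (f ` A) = card A" if "A \<in> Fpow X" for A
    using that f by (auto simp: Fpow_def intro!: card_image inj_on_subset[OF f(1)])
  show ?thesis
  proof (rule integral_diversity_onI)
    fix A B assume AB: "A \<in> Fpow X" "B \<in> Fpow X" "A \<inter> B \<noteq> {}"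
    then have "f ` A \<inter> f ` B \<noteq> {}" by auto
    then show "d (f ` (A \<union> B)) \<le> d (f ` A) + d (f ` B)"
      using integral_diversity_onD(6)[OF d] im AB by (simp add: image_Un)
  next
    fix A B assume B: "B \<in> Fpow X" "A \<subseteq> B"
    then show "d (f ` A) \<le> d (f ` B)"
      using integral_diversity_onD(5)[OF d im(1)] by (simp add: image_mono)
  qed (use integral_diversity_onD[OF d im(1)] im(2) in auto)
qed

text \<open>
  Replace each point \<open>y\<close> by the cluster of the points over it under \<open>p\<close>.  The freedom in \<open>d\<close> allows some
  tuples of the blown up space to have the values of \<open>e0\<close> and others those of \<open>e1\<close>.  The only possible
  failure of subadditivity is a union of value \<open>k + 1\<close> covered by sets of total value \<open>k\<close> for \<open>e0\<close>; if
  one of the two sets has been lowered, it contributes \<open>k\<close> by itself, and the other one has at least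
  two points and hence contributes another \<open>1\<close>.
\<close>

lemma integral_diversity_on_blowup:
  fixes p :: "'b \<Rightarrow> 'a" and k :: real
  assumes e0: "integral_diversity_on (p ` X) e0" and e1: "integral_diversity_on (p ` X) e1"
    and jump: "\<And>F. F \<in> Fpow (p ` X) \<Longrightarrow> e1 F = e0 F \<or> e0 F = k \<and> e1 F = k + 1"
    and int: "\<And>F. F \<in> Fpow X \<Longrightarrow> d F \<in> \<int>"
    and mono: "\<And>E F. F \<in> Fpow X \<Longrightarrow> E \<subseteq> F \<Longrightarrow> d E \<le> d F"
    and lower: "\<And>F. F \<in> Fpow X \<Longrightarrow> max (e0 (p ` F)) (of_bool (2 \<le> card F)) \<le> d F"
    and upper: "\<And>F. F \<in> Fpow X \<Longrightarrow> d F \<le> max (e1 (p ` F)) (of_bool (2 \<le> card F))"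
  shows "integral_diversity_on X d"
proof (rule integral_diversity_onI[OF int])
  have im: "p ` F \<in> Fpow (p ` X)" "finite F" "card (p ` F) \<le> card F" if "F \<in> Fpow X" for F
    using that by (auto simp: Fpow_def intro: card_image_le)
  {
    fix A assume A: "A \<in> Fpow X" "card A \<le> 1"
    then have "card (p ` A) \<le> 1" using im(3)[OF A(1)] by simp
    then have "e0 (p ` A) = 0" "e1 (p ` A) = 0"
      using integral_diversity_onD(3)[OF e0] integral_diversity_onD(3)[OF e1] im(1)[OF A(1)] by auto
    then show "d A = 0" using lower[OF A(1)] upper[OF A(1)] A(2) by simp
  }
  show "1 \<le> d A" if "A \<in> Fpow X" "2 \<le> card A" for A using lower[OF that(1)] that(2) by simp
  show "d A \<le> d B" if "B \<in> Fpow X" "A \<subseteq> B" for A B using mono that .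
  fix S T assume ST: "S \<in> Fpow X" "T \<in> Fpow X" "S \<inter> T \<noteq> {}"
  then have U: "S \<union> T \<in> Fpow X" by (auto simp: Fpow_def)
  have nonneg: "0 \<le> d F" if "F \<in> Fpow X" for F using lower[OF that] by (cases "2 \<le> card F") simp_all
  \<comment> \<open>If neither set contains the other, both have at least two points.\<close>
  show "d (S \<union> T) \<le> d S + d T"
  proof (cases "S \<subseteq> T \<or> T \<subseteq> S")
    case True
    then show ?thesis using nonneg ST by (auto simp: Un_absorb1 Un_absorb2)
  next
    case False
    have two: "2 \<le> card S" "2 \<le> card T"
    proof -
      obtain x s t where "x \<in> S" "x \<in> T" "s \<in> S" "s \<notin> T" "t \<in> T" "t \<notin> S"
        using False ST(3) by blast
      then have "x \<noteq> s" "x \<noteq> t" "{x, s} \<subseteq> S" "{x, t} \<subseteq> T" by auto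
      then have "{x, s} \<subseteq> S" "{x, t} \<subseteq> T" "card {x, s} = 2" "card {x, t} = 2" by auto
      then show "2 \<le> card S" "2 \<le> card T" using card_mono im(2) ST by metis+
    qed
    have pim: "p ` S \<inter> p ` T \<noteq> {}" using ST(3) by auto
    note sub = integral_diversity_onD(6)[OF e0 im(1)[OF ST(1)] im(1)[OF ST(2)] pim]
      integral_diversity_onD(6)[OF e1 im(1)[OF ST(1)] im(1)[OF ST(2)] pim]
    have low: "1 \<le> d S" "1 \<le> d T" "e0 (p ` S) \<le> d S" "e0 (p ` T) \<le> d T"
      using lower[OF ST(1)] lower[OF ST(2)] two by auto
    have "d (S \<union> T) \<le> max (e1 (p ` S \<union> p ` T)) (of_bool (2 \<le> card (S \<union> T)))"
      using upper[OF U] by (simp only: image_Un)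
    also have "\<dots> \<le> max (e1 (p ` S \<union> p ` T)) 1" by (intro max.mono order_refl) simp
    finally have "d (S \<union> T) \<le> max (e1 (p ` S \<union> p ` T)) 1" .
    moreover have "e1 (p ` S \<union> p ` T) \<le> d S + d T"
    proof (cases "e1 (p ` S \<union> p ` T) = e0 (p ` S \<union> p ` T)")
      case True
      with sub(1) low show ?thesis by linarith
    next
      case False
      then have "e1 (p ` S \<union> p ` T) = k + 1" using jump[OF im(1)[OF U]] by (auto simp: image_Un)
      with jump[OF im(1)[OF ST(1)]] jump[OF im(1)[OF ST(2)]] sub(2) low show ?thesis by linarith
    qed
    ultimately show ?thesis using low by linarith
  qed
qed

section \<open>The integral limit\<close>

locale integral_limit =
  fixes \<delta> :: "'a set \<Rightarrow> real"
  assumes limit: "integral_Fraisse_limit \<delta>"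
begin

abbreviation G :: "('a \<Rightarrow> 'a) set" where "G \<equiv> diversity_Aut \<delta>"
abbreviation Stab :: "'a set \<Rightarrow> ('a \<Rightarrow> 'a) set" where "Stab \<equiv> pointwise_stabilizer G"

lemma integral_diversity: "integral_diversity_on UNIV \<delta>"
  using limit by (simp add: integral_Fraisse_limit_def)

lemma integral_diversity_on: "integral_diversity_on X \<delta>"
  using integral_diversity_on_pullback[OF integral_diversity, of id X] by simp

lemma G_iff: "g \<in> G \<longleftrightarrow> bij g \<and> (\<forall>A. finite A \<longrightarrow> \<delta> (g ` A) = \<delta> A)"
  by (auto simp: diversity_Aut_def diversity_iso_def diversity_embedding_def bij_def Fpow_def)

lemma id_in_G: "id \<in> G"
  by (simp add: G_iff)

lemma comp_in_G: "g \<in> G \<Longrightarrow> h \<in> G \<Longrightarrow> g \<circ> h \<in> G"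
  by (metis G_iff bij_comp finite_imageI image_comp)

lemma inv_in_G: assumes "g \<in> G" shows "inv g \<in> G"
proof -
  have g: "bij g" using assms by (simp add: G_iff)
  have "\<delta> (inv g ` A) = \<delta> A" if "finite A" for A
  proof -
    have "\<delta> (g ` inv g ` A) = \<delta> (inv g ` A)" using assms that by (simp add: G_iff)
    then show ?thesis using g by (simp add: image_f_inv_f bij_is_surj)
  qed
  with g show ?thesis by (simp add: G_iff bij_imp_bij_inv)
qed

lemma comp_in_Stab: "g \<in> Stab C \<Longrightarrow> h \<in> Stab C \<Longrightarrow> g \<circ> h \<in> Stab C"
  by (auto simp: pointwise_stabilizer_def comp_in_G)

lemma inv_in_Stab: assumes "g \<in> Stab C" shows "inv g \<in> Stab C"
proof -
  have "bij g" using assms by (simp add: pointwise_stabilizer_def G_iff)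
  then have "inv g c = c" if "g c = c" for c using that by (metis bij_inv_eq_iff)
  then show ?thesis using assms by (simp add: pointwise_stabilizer_def inv_in_G)
qed

lemma inj_on_if_preserves_diversity:
  assumes d: "integral_diversity_on Y d" and f: "\<And>F. F \<in> Fpow Y \<Longrightarrow> \<delta> (f ` F) = d F"
  shows "inj_on f Y"
proof (rule inj_onI, rule ccontr)
  fix x y assume xy: "x \<in> Y" "y \<in> Y" "f x = f y" "x \<noteq> y"
  then have "{x, y} \<in> Fpow Y" "card {x, y} = 2" by (auto simp: Fpow_def)
  then have "1 \<le> d {x, y}" using integral_diversity_onD(4)[OF d] by simp
  moreover have "\<delta> (f ` {x, y}) = 0"
    using xy integral_diversity_onD(3)[OF integral_diversity, of "{f y}"] by (simp add: Fpow_def)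
  ultimately show False using f[of "{x, y}"] \<open>{x, y} \<in> Fpow Y\<close> by simp
qed

lemma homogeneous:
  assumes S: "finite S" and f: "\<And>F. F \<subseteq> S \<Longrightarrow> \<delta> (f ` F) = \<delta> F"
  obtains g where "g \<in> G" "\<And>x. x \<in> S \<Longrightarrow> g x = f x"
proof -
  have "diversity_iso S \<delta> (f ` S) \<delta> f"
    using f inj_on_if_preserves_diversity[OF integral_diversity_on, of S f]
    by (simp add: diversity_iso_def diversity_embedding_def Fpow_def)
  moreover have "finite (f ` S)" using S by simp
  ultimately have "\<exists>g\<in>G. \<forall>x\<in>S. g x = f x"
    using S limit unfolding integral_Fraisse_limit_def by blast
  then show ?thesis using that by blast
qed

text \<open>
  The extension property of the limit: embed all of \<open>Y\<close> somewhere, then move the image by an automorphism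
  so that it agrees with the given embedding on \<open>S\<close>.
\<close>

lemma extend_embedding:
  fixes Y :: "'b set"
  assumes Y: "finite Y" and d: "integral_diversity_on Y d" and S: "S \<subseteq> Y"
    and e: "\<And>F. F \<subseteq> S \<Longrightarrow> \<delta> (e ` F) = d F"
  obtains f where "\<And>F. F \<subseteq> Y \<Longrightarrow> \<delta> (f ` F) = d F" "\<And>s. s \<in> S \<Longrightarrow> f s = e s"
proof -
  have fin: "finite F" if "F \<subseteq> Y" for F using that Y finite_subset by blast
  obtain t :: "'b \<Rightarrow> nat" where t: "inj_on t Y"
    using finite_imp_inj_to_nat_seg[OF Y] by blast
  let ?u = "inv_into Y t"
  have "integral_diversity_on (t ` Y) (\<lambda>F. d (?u ` F))"
    by (rule integral_diversity_on_pullback[OF d]) (use t in \<open>auto intro: inj_on_inv_into\<close>)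
  moreover have "finite (t ` Y)" using Y by simp
  ultimately obtain h where h: "diversity_embedding (t ` Y) (\<lambda>F. d (?u ` F)) UNIV \<delta> h"
    using limit unfolding integral_Fraisse_limit_def by blast
  define h' where "h' = h \<circ> t"
  have h': "\<delta> (h' ` F) = d F" if "F \<subseteq> Y" for F
  proof -
    have "t ` F \<in> Fpow (t ` Y)" using that fin by (auto simp: Fpow_def)
    then have "\<delta> (h ` t ` F) = d (?u ` t ` F)" using h by (simp add: diversity_embedding_def)
    also have "?u ` t ` F = F" using t that by (rule inv_into_image_cancel)
    finally show ?thesis by (simp add: h'_def image_comp)
  qed
  have dS: "integral_diversity_on S d"
    using integral_diversity_on_pullback[OF d, of id S] S by simp
  have inj: "inj_on e S" using inj_on_if_preserves_diversity[OF dS] e by (simp add: Fpow_def)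
  have "\<delta> ((h' \<circ> inv_into S e) ` F) = \<delta> F" if F: "F \<subseteq> e ` S" for F
  proof -
    obtain F' where F': "F' \<subseteq> S" "F = e ` F'" using F by (auto simp: subset_image_iff)
    have "(h' \<circ> inv_into S e) ` F = h' ` inv_into S e ` e ` F'" by (simp add: F' image_comp)
    also have "\<dots> = h' ` F'" using inv_into_image_cancel[OF inj F'(1)] by simp
    finally show ?thesis using h' e F' S by simp
  qed
  moreover have "finite (e ` S)" using fin[OF S] by simp
  ultimately obtain g where g: "g \<in> G" "\<And>x. x \<in> e ` S \<Longrightarrow> g x = (h' \<circ> inv_into S e) x"
    using homogeneous[of "e ` S" "h' \<circ> inv_into S e"] by blast
  have bij: "bij g" using g by (simp add: G_iff)
  show ?thesis
  proof (rule that[of "inv g \<circ> h'"])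
    show "\<delta> ((inv g \<circ> h') ` F) = d F" if "F \<subseteq> Y" for F
    proof -
      have "\<delta> (inv g ` (h' ` F)) = \<delta> (h' ` F)"
        using inv_in_G[OF g(1)] fin[OF that] by (simp add: G_iff)
      then show ?thesis using h'[OF that] by (simp add: image_comp)
    qed
    show "(inv g \<circ> h') s = e s" if "s \<in> S" for s
      using g(2)[of "e s"] that inj bij by (simp add: bij_inv_eq_iff) (metis bij_inv_eq_iff)
  qed
qed

text \<open>
  The case \<open>x = y\<close> is allowed, so that the lemma covers single points as well as pairs.
\<close>

lemma same_type_conjugate:
  assumes C: "finite C" and xy: "x \<notin> C" "y \<notin> C" "x' \<notin> C" "y' \<notin> C" "x = y \<longleftrightarrow> x' = y'"
    and x: "\<And>E. E \<subseteq> C \<Longrightarrow> \<delta> (insert x E) = \<delta> (insert x' E)"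
    and y: "\<And>E. E \<subseteq> C \<Longrightarrow> \<delta> (insert y E) = \<delta> (insert y' E)"
    and both: "\<And>E. E \<subseteq> C \<Longrightarrow> \<delta> (insert x (insert y E)) = \<delta> (insert x' (insert y' E))"
  obtains g where "g \<in> Stab C" "g x = x'" "g y = y'"
proof -
  define f where "f = (\<lambda>c. if c = x then x' else if c = y then y' else c)"
  have fx: "f x = x'" and fy: "f y = y'" using xy(5) by (auto simp: f_def)
  have fC: "f ` E = E" if "E \<subseteq> C" for E
  proof -
    have "f c = c" if "c \<in> E" for c using that \<open>E \<subseteq> C\<close> xy by (auto simp: f_def)
    then show ?thesis by simp
  qed
  have "\<delta> (f ` F) = \<delta> F" if "F \<subseteq> insert x (insert y C)" for F
  proof -
    define E where "E = F \<inter> C"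
    have E: "E \<subseteq> C" by (simp add: E_def)
    have "F = E \<or> F = insert x E \<or> F = insert y E \<or> F = insert x (insert y E)"
      using that by (auto simp: E_def)
    then show ?thesis using x[OF E] y[OF E] both[OF E] fC[OF E] fx fy by auto
  qed
  then obtain g where g: "g \<in> G" "\<And>c. c \<in> insert x (insert y C) \<Longrightarrow> g c = f c"
    using homogeneous[of "insert x (insert y C)" f] C by auto
  have "g c = c" if "c \<in> C" for c using g(2)[of c] that fC[of "{c}"] by simp
  then have "g \<in> Stab C" using g(1) by (simp add: pointwise_stabilizer_def)
  moreover have "g x = x'" "g y = y'" using g(2) fx fy by simp_all
  ultimately show ?thesis by (rule that)
qed

text \<open>
  The points \<open>z i\<close> are clones of \<open>a\<close> that are indistinguishable over \<open>C\<close>, also in pairs, while over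
  \<open>C \<union> {b}\<close> those with even index have the type \<open>e0\<close> and those with odd index the type \<open>e1\<close>.  They are
  obtained by realizing in the limit a blow-up in which \<open>a\<close> becomes a cluster of clones.
\<close>

lemma twin_family:
  fixes e0 e1 :: "'a set \<Rightarrow> real" and N :: nat
  assumes C: "finite C" "a \<notin> C" and b: "b \<notin> C" "a \<noteq> b"
    and e0: "integral_diversity_on (insert a (insert b C)) e0"
    and e1: "integral_diversity_on (insert a (insert b C)) e1"
    and jump: "\<And>F. F \<subseteq> insert a (insert b C) \<Longrightarrow> e1 F = e0 F \<or> e0 F = k \<and> e1 F = k + 1"
    and e0_old: "\<And>F. F \<subseteq> insert a (insert b C) \<Longrightarrow> \<not> {a, b} \<subseteq> F \<Longrightarrow> e0 F = \<delta> F"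
    and e1_old: "\<And>F. F \<subseteq> insert a (insert b C) \<Longrightarrow> \<not> {a, b} \<subseteq> F \<Longrightarrow> e1 F = \<delta> F"
  obtains z :: "nat \<Rightarrow> 'a" where "inj_on z {..<N}" "\<And>i. i < N \<Longrightarrow> z i \<notin> insert b C"
    and "\<And>i E. i < N \<Longrightarrow> E \<subseteq> insert b C \<Longrightarrow>
           \<delta> (insert (z i) E) = (if even i then e0 else e1) (insert a E)"
    and "\<And>i j E. i < N \<Longrightarrow> j < N \<Longrightarrow> i \<noteq> j \<Longrightarrow> E \<subseteq> C \<Longrightarrow>
           \<delta> (insert (z i) (insert (z j) E)) = max 1 (\<delta> (insert a E))"
proof -
  define S where "S = insert b C \<times> {0::nat}"
  \<comment> \<open>One clone more than required, so that the cluster is not empty when \<open>N = 0\<close>.\<close>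
  define X where "X = S \<union> {a} \<times> {..N}"
  \<comment> \<open>Exactly the sets with \<open>b\<close> and a clone of odd index receive the values of \<open>e1\<close>.\<close>
  define raised where "raised F \<longleftrightarrow> b \<in> fst ` F \<and> (\<exists>i. odd i \<and> (a, i) \<in> F)" for F :: "('a \<times> nat) set"
  define d where "d F = max (of_bool (2 \<le> card F)) ((if raised F then e1 else e0) (fst ` F))" for F
  have finX: "finite X" "finite S" using C by (auto simp: X_def S_def)
  have fstX: "fst ` X = insert a (insert b C)" by (force simp: X_def S_def)
  have fstF: "fst ` F \<subseteq> insert a (insert b C)" if "F \<subseteq> X" for F using that fstX by blast
  have e01: "e0 F \<le> e1 F" if "F \<subseteq> insert a (insert b C)" for F using jump[OF that] by auto
  have dX: "integral_diversity_on X d"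
  proof (rule integral_diversity_on_blowup)
    show "integral_diversity_on (fst ` X) e0" "integral_diversity_on (fst ` X) e1"
      using e0 e1 by (simp_all add: fstX)
    show "e1 F = e0 F \<or> e0 F = k \<and> e1 F = k + 1" if "F \<in> Fpow (fst ` X)" for F
      using jump[of F] that by (simp add: fstX Fpow_def)
  next
    fix F assume F: "F \<in> Fpow X"
    then have im: "fst ` F \<in> Fpow (insert a (insert b C))" using fstF by (auto simp: Fpow_def)
    then show "d F \<in> \<int>"
      using integral_diversity_onD(1)[OF e0] integral_diversity_onD(1)[OF e1]
      by (auto simp: d_def max_def)
    show "max (e0 (fst ` F)) (of_bool (2 \<le> card F)) \<le> d F"
      "d F \<le> max (e1 (fst ` F)) (of_bool (2 \<le> card F))"
      using e01[of "fst ` F"] im by (auto simp: d_def Fpow_def)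
    fix E assume EF: "E \<subseteq> F"
    have "card E \<le> card F" using EF F by (auto simp: Fpow_def intro: card_mono)
    then have c: "of_bool (2 \<le> card E) \<le> (of_bool (2 \<le> card F) :: real)" by auto
    have imE: "fst ` E \<subseteq> fst ` F" using EF by blast
    have "raised E \<Longrightarrow> raised F" using EF by (auto simp: raised_def)
    moreover have "e0 (fst ` E) \<le> e0 (fst ` F)" "e1 (fst ` E) \<le> e1 (fst ` F)"
      using integral_diversity_onD(5)[OF e0 im imE] integral_diversity_onD(5)[OF e1 im imE] .
    moreover have "e0 (fst ` F) \<le> e1 (fst ` F)" using e01 im by (simp add: Fpow_def)
    ultimately have "(if raised E then e1 else e0) (fst ` E) \<le> (if raised F then e1 else e0) (fst ` F)"
      by auto
    with c show "d E \<le> d F" unfolding d_def by (rule max.mono)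
  qed
  have "\<delta> (fst ` F) = d F" if F: "F \<subseteq> S" for F
  proof -
    have FC: "fst ` F \<subseteq> insert b C" and "a \<notin> fst ` F" using F C b by (auto simp: S_def)
    then have "\<not> raised F" by (force simp: raised_def)
    moreover have "e0 (fst ` F) = \<delta> (fst ` F)" using FC \<open>a \<notin> fst ` F\<close> by (intro e0_old) auto
    moreover have "of_bool (2 \<le> card F) \<le> \<delta> (fst ` F)"
    proof -
      have "inj_on fst F" using F by (auto simp: S_def inj_on_def)
      then have "card (fst ` F) = card F" by (rule card_image)
      moreover have "fst ` F \<in> Fpow UNIV" using F finX(2) finite_subset by (auto simp: Fpow_def)
      ultimately show ?thesis
        using integral_diversity_onD(2,4)[OF integral_diversity, of "fst ` F"] by auto
    qed
    ultimately show ?thesis by (simp add: d_def)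
  qed
  moreover have "S \<subseteq> X" by (simp add: X_def)
  ultimately obtain f where f: "\<And>F. F \<subseteq> X \<Longrightarrow> \<delta> (f ` F) = d F" "\<And>s. s \<in> S \<Longrightarrow> f s = fst s"
    using extend_embedding[OF finX(1) dX, of S fst] by blast
  have inj: "inj_on f X" using inj_on_if_preserves_diversity[OF dX] f(1) by (simp add: Fpow_def)
  define z where "z i = f (a, i)" for i
  have aX: "(a, i) \<in> X" if "i < N" for i using that by (simp add: X_def)
  have lift: "E \<times> {0} \<subseteq> S" "f ` (E \<times> {0}) = E" "fst ` (E \<times> {0::nat}) = E" if "E \<subseteq> insert b C" for E
  proof -
    show S: "E \<times> {0} \<subseteq> S" using that by (auto simp: S_def)
    show fst: "fst ` (E \<times> {0::nat}) = E" by simp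
    have "f ` (E \<times> {0}) = fst ` (E \<times> {0::nat})" using S f(2) by (intro image_cong) auto
    then show "f ` (E \<times> {0}) = E" using fst by simp
  qed
  show ?thesis
  proof (rule that[of z])
    show "inj_on z {..<N}" using inj aX by (auto simp: inj_on_def z_def)
  next
    fix i assume i: "i < N"
    have "(a, i) \<notin> S" using C b by (simp add: S_def)
    then have "z i \<notin> f ` S" unfolding z_def using inj aX[OF i] \<open>S \<subseteq> X\<close> by (auto simp: inj_on_def)
    moreover have "f ` S = insert b C" unfolding S_def by (rule lift(2)) simp
    ultimately show "z i \<notin> insert b C" by simp
  next
    fix i E assume i: "i < N" and E: "E \<subseteq> insert b C"
    let ?F = "insert (a, i) (E \<times> {0})"
    have FX: "?F \<subseteq> X" using lift(1)[OF E] aX[OF i] by (auto simp: X_def)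
    have "insert (z i) E = f ` ?F" using lift(2)[OF E] by (simp add: z_def)
    then have "\<delta> (insert (z i) E) = d ?F" using f(1)[OF FX] by simp
    moreover have fstF': "fst ` ?F = insert a E" using lift(3)[OF E] by simp
    moreover have "raised ?F \<longleftrightarrow> b \<in> E \<and> odd i"
      using E C b by (auto simp: raised_def image_insert lift(3)[OF E] simp del: fst_image_times)
    moreover have "of_bool (2 \<le> card ?F) \<le> e0 (insert a E)"
    proof -
      have Ef: "finite E" "a \<notin> E" using E C b finite_subset[OF E] by auto
      have "card ?F = Suc (card E)"
        using Ef by (subst card_insert_disjoint) (auto simp: card_cartesian_product)
      moreover have "card (insert a E) = Suc (card E)" using Ef by simp
      moreover have "insert a E \<in> Fpow (insert a (insert b C))" using Ef E by (auto simp: Fpow_def)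
      ultimately show ?thesis
        using integral_diversity_onD(2,4)[OF e0, of "insert a E"] by auto
    qed
    moreover have "e0 (insert a E) \<le> e1 (insert a E)" using E by (intro e01) auto
    moreover have "e1 (insert a E) = e0 (insert a E)" if "b \<notin> E"
    proof -
      have "insert a E \<subseteq> insert a (insert b C)" "\<not> {a, b} \<subseteq> insert a E" using E that b by auto
      then show ?thesis using e0_old e1_old by simp
    qed
    ultimately show "\<delta> (insert (z i) E) = (if even i then e0 else e1) (insert a E)"
      unfolding d_def by auto
  next
    fix i j E assume ij: "i < N" "j < N" "i \<noteq> j" and E: "E \<subseteq> C"
    let ?F = "insert (a, i) (insert (a, j) (E \<times> {0}))"
    have E': "E \<subseteq> insert b C" using E by blast
    have FX: "?F \<subseteq> X" using lift(1)[OF E'] aX ij by (auto simp: X_def)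
    have "insert (z i) (insert (z j) E) = f ` ?F" using lift(2)[OF E'] by (simp add: z_def)
    then have "\<delta> (insert (z i) (insert (z j) E)) = d ?F" using f(1)[OF FX] by simp
    moreover have fstF': "fst ` ?F = insert a E" using lift(3)[OF E'] by simp
    moreover have "b \<notin> insert a E" using b E by auto
    then have "\<not> raised ?F" unfolding raised_def fstF' by simp
    moreover have "2 \<le> card ?F"
    proof -
      have "finite ?F" by (rule finite_subset[OF FX finX(1)])
      moreover have "card {(a, i), (a, j)} = 2" using ij by simp
      ultimately show ?thesis using card_mono[of ?F "{(a, i), (a, j)}"] by simp
    qed
    moreover have "e0 (insert a E) = \<delta> (insert a E)" using E b by (intro e0_old) auto
    ultimately show "\<delta> (insert (z i) (insert (z j) E)) = max 1 (\<delta> (insert a E))"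
      by (simp add: d_def)
  qed
qed

end

section \<open>Unitary representations of the automorphism group\<close>

locale limit_representation = integral_limit \<delta> for \<delta> :: "'a set \<Rightarrow> real" +
  fixes \<pi> :: "('a \<Rightarrow> 'a) \<Rightarrow> 'h::complex_hilbert_space \<Rightarrow> 'h"
  assumes representation: "unitary_representation (diversity_Aut \<delta>) \<pi>"
begin

abbreviation H :: "'a set \<Rightarrow> 'h set" where "H \<equiv> fixed_vectors G \<pi>"

lemma Stab_G: "g \<in> Stab A \<Longrightarrow> g \<in> G"
  by (simp add: pointwise_stabilizer_def)

lemma Stab_mono: "A \<subseteq> B \<Longrightarrow> Stab B \<subseteq> Stab A"
  by (auto simp: pointwise_stabilizer_def)

lemma unitary_pi: "g \<in> G \<Longrightarrow> unitary (\<pi> g)"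
  using representation by (simp add: unitary_representation_def)

lemma pi_comp: "g \<in> G \<Longrightarrow> h \<in> G \<Longrightarrow> \<pi> (g \<circ> h) x = \<pi> g (\<pi> h x)"
  using representation by (simp add: unitary_representation_def)

lemma pi_inner: "g \<in> G \<Longrightarrow> \<pi> g x \<bullet> \<pi> g y = x \<bullet> y"
  using unitary_pi by (simp add: unitary_def inner_eq_Re_cinner)

lemma bounded_linear_pi: assumes "g \<in> G" shows "bounded_linear (\<pi> g)"
proof (rule bounded_linear_intro[where K = 1])
  show "\<pi> g (x + y) = \<pi> g x + \<pi> g y" "\<pi> g (r *\<^sub>R x) = r *\<^sub>R \<pi> g x" for x y r
    using unitary_pi[OF assms] by (simp_all add: unitary_def scaleR_scaleC)
  show "norm (\<pi> g x) \<le> norm x * 1" for x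
    using pi_inner[OF assms, of x x] by (simp add: norm_eq_sqrt_inner)
qed

lemma pi_norm: "g \<in> G \<Longrightarrow> norm (\<pi> g x) = norm x"
  using pi_inner[of g x x] by (simp add: norm_eq_sqrt_inner)

lemma pi_id: "\<pi> id x = x"
proof -
  obtain y where y: "x = \<pi> id y" using unitary_pi[OF id_in_G] unfolding unitary_def by (metis surjD)
  show ?thesis using pi_comp[OF id_in_G id_in_G, of y] by (simp add: y)
qed

lemma pi_inv: assumes "g \<in> G" shows "\<pi> g (\<pi> (inv g) x) = x"
proof -
  have "g \<circ> inv g = id" using assms by (simp add: G_iff bij_is_surj flip: surj_iff)
  then show ?thesis using pi_comp[OF assms inv_in_G[OF assms], of x] pi_id by simp
qed

lemma pi_adjoint: "g \<in> G \<Longrightarrow> \<pi> g x \<bullet> y = x \<bullet> \<pi> (inv g) y"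
  by (metis pi_inner pi_inv)

lemma fixed_by_Stab: "\<xi> \<in> H A \<Longrightarrow> g \<in> Stab A \<Longrightarrow> \<pi> g \<xi> = \<xi>"
  by (simp add: fixed_vectors_def)

lemma H_mono: "A \<subseteq> B \<Longrightarrow> H A \<subseteq> H B"
  unfolding fixed_vectors_def using Stab_mono[of A B] by blast

lemma subspace_H: "subspace (H A)"
  using bounded_linear_pi Stab_G
  by (auto simp: subspace_def fixed_vectors_def linear_simps bounded_linear.linear linear_0)

lemma closed_H: "closed (H A)"
proof -
  have "H A = (\<Inter>g\<in>Stab A. {\<xi>. \<pi> g \<xi> = \<xi>})" by (auto simp: fixed_vectors_def)
  also have "closed \<dots>"
    by (intro closed_INT ballI closed_Collect_eq linear_continuous_on bounded_linear_pi Stab_G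
        continuous_on_id)
  finally show ?thesis .
qed

lemma scaleC_H: "\<xi> \<in> H A \<Longrightarrow> c *\<^sub>C \<xi> \<in> H A"
  using unitary_pi Stab_G by (auto simp: fixed_vectors_def unitary_def)

lemma translate_in_H:
  assumes "\<xi> \<in> H (insert a C)" "g \<in> Stab C" shows "\<pi> g \<xi> \<in> H (insert (g a) C)"
  unfolding fixed_vectors_def
proof safe
  fix h assume h: "h \<in> Stab (insert (g a) C)"
  have g: "g \<in> G" and bij: "bij g" using assms Stab_G G_iff by auto
  have "h \<in> Stab C" using h Stab_mono by blast
  then have "inv g \<circ> (h \<circ> g) \<in> Stab C" using assms by (intro comp_in_Stab inv_in_Stab)
  moreover have "inv g (h (g a)) = a"
    using h bij by (simp add: pointwise_stabilizer_def bij_is_inj)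
  ultimately have "inv g \<circ> (h \<circ> g) \<in> Stab (insert a C)" by (simp add: pointwise_stabilizer_def)
  then have "\<pi> (inv g \<circ> (h \<circ> g)) \<xi> = \<xi>" using assms fixed_by_Stab by blast
  then have "\<pi> (inv g) (\<pi> h (\<pi> g \<xi>)) = \<xi>"
    using pi_comp[OF inv_in_G[OF g] comp_in_G[OF Stab_G[OF h] g]] pi_comp[OF Stab_G[OF h] g] by simp
  then show "\<pi> h (\<pi> g \<xi>) = \<pi> g \<xi>" using pi_inv[OF g] by metis
qed

text \<open>
  The translates of \<open>\<xi>\<close> under the stabilizer of \<open>C\<close> are thus indexed by the orbit of \<open>a\<close>.
\<close>

lemma translate_determined:
  assumes "\<xi> \<in> H (insert a C)" "g \<in> Stab C" "h \<in> Stab C" "g a = h a"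
  shows "\<pi> g \<xi> = \<pi> h \<xi>"
proof -
  have gG: "g \<in> G" "h \<in> G" "bij h" using assms Stab_G G_iff by auto
  have "inv h \<circ> g \<in> Stab C" using assms by (intro comp_in_Stab inv_in_Stab)
  moreover have "inv h (g a) = a" using assms(4) gG by (simp add: bij_is_inj)
  ultimately have "inv h \<circ> g \<in> Stab (insert a C)" by (simp add: pointwise_stabilizer_def)
  then have "\<pi> (inv h) (\<pi> g \<xi>) = \<xi>"
    using assms fixed_by_Stab pi_comp[OF inv_in_G[OF gG(2)] gG(1)] by metis
  then show ?thesis using pi_inv[OF gG(2)] by metis
qed

lemma Stab_notin: assumes "g \<in> Stab C" "a \<notin> C" shows "g a \<notin> C"
proof
  assume "g a \<in> C"
  then have "g (g a) = g a" using assms by (simp add: pointwise_stabilizer_def)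
  moreover have "inj g" using assms Stab_G by (simp add: G_iff bij_is_inj)
  ultimately have "g a = a" by (simp add: inj_eq)
  with \<open>g a \<in> C\<close> assms show False by simp
qed

section \<open>Matrix coefficients are constant\<close>

text \<open>
  The function \<open>e\<close> is the diversity of a configuration on \<open>C \<union> {a, b}\<close> in which \<open>a\<close> stands for the
  point \<open>x\<close>: it records the type of \<open>x\<close> over \<open>C \<union> {b}\<close>.
\<close>

definition realizes :: "'a set \<Rightarrow> 'a \<Rightarrow> 'a \<Rightarrow> ('a set \<Rightarrow> real) \<Rightarrow> 'a \<Rightarrow> bool" where
  "realizes C a b e x \<longleftrightarrow>
     x \<notin> insert b C \<and> (\<forall>E. E \<subseteq> insert b C \<longrightarrow> \<delta> (insert x E) = e (insert a E))"

text \<open>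
  These are the possible types over \<open>C \<union> {b}\<close> of the points in the orbit of \<open>a\<close> under the stabilizer of
  \<open>C\<close>, apart from \<open>b\<close>: only the values on sets with both \<open>a\<close> and \<open>b\<close> may differ from \<open>\<delta>\<close>.
\<close>

definition joint_type :: "'a set \<Rightarrow> 'a \<Rightarrow> 'a \<Rightarrow> ('a set \<Rightarrow> real) \<Rightarrow> bool" where
  "joint_type C a b e \<longleftrightarrow> integral_diversity_on (insert a (insert b C)) e \<and>
     (\<forall>F. F \<subseteq> insert a (insert b C) \<longrightarrow> \<not> {a, b} \<subseteq> F \<longrightarrow> e F = \<delta> F)"

lemma joint_type_realized:
  assumes C: "finite C" "a \<notin> C" "b \<notin> C" "a \<noteq> b" and e: "joint_type C a b e"
  obtains g where "g \<in> Stab C" "realizes C a b e (g a)"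
proof -
  obtain z :: "nat \<Rightarrow> 'a" where z: "\<And>i. i < 1 \<Longrightarrow> z i \<notin> insert b C"
    "\<And>i E. i < 1 \<Longrightarrow> E \<subseteq> insert b C \<Longrightarrow> \<delta> (insert (z i) E) = (if even i then e else e) (insert a E)"
    by (rule twin_family[of C a b e e 0 1]) (use C e in \<open>auto simp: joint_type_def\<close>)
  have "\<delta> (insert a E) = \<delta> (insert (z 0) E)" if "E \<subseteq> C" for E
  proof -
    have "insert a E \<subseteq> insert a (insert b C)" "\<not> {a, b} \<subseteq> insert a E" using that C by auto
    then have "e (insert a E) = \<delta> (insert a E)" using e by (simp add: joint_type_def)
    moreover have "E \<subseteq> insert b C" using that by blast
    ultimately show ?thesis using z(2)[of 0 E] by simp
  qed
  then obtain g where "g \<in> Stab C" "g a = z 0"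
    using same_type_conjugate[of C a a "z 0" "z 0"] C z(1)[of 0] by auto
  moreover have "realizes C a b e (z 0)" using z by (simp add: realizes_def)
  ultimately show ?thesis using that by metis
qed

text \<open>
  Consider the translates \<open>w i\<close> of \<open>\<xi>\<close> at the points of a family of \<open>2 * N\<close> twins.  Those with even index
  have the same inner product with \<open>v\<close> as the translate by \<open>g0\<close>, those with odd index as the translate
  by \<open>g1\<close>.  Since all pairs of twins are conjugate over \<open>C\<close>, the differences of consecutive translates
  are orthogonal, and their common inner product with \<open>v\<close> must vanish.
\<close>

lemma coefficient_eq_twins:
  assumes C: "finite C" "a \<notin> C" "b \<notin> C" "a \<noteq> b"
    and e0: "joint_type C a b e0" and e1: "joint_type C a b e1"
    and jump: "\<And>F. F \<subseteq> insert a (insert b C) \<Longrightarrow> e1 F = e0 F \<or> e0 F = k \<and> e1 F = k + 1"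
    and g0: "g0 \<in> Stab C" "realizes C a b e0 (g0 a)"
    and g1: "g1 \<in> Stab C" "realizes C a b e1 (g1 a)"
    and \<xi>: "\<xi> \<in> H (insert a C)" and v: "v \<in> H (insert b C)"
  shows "\<pi> g0 \<xi> \<bullet> v = \<pi> g1 \<xi> \<bullet> v"
proof -
  have "\<exists>u::nat \<Rightarrow> 'h. (\<forall>i<N. u i \<bullet> v = \<pi> g0 \<xi> \<bullet> v - \<pi> g1 \<xi> \<bullet> v \<and> norm (u i) \<le> 2 * norm \<xi>) \<and>
      (\<forall>i<N. \<forall>j<N. i \<noteq> j \<longrightarrow> u i \<bullet> u j = 0)" for N :: nat
  proof -
    obtain z :: "nat \<Rightarrow> 'a" where inj: "inj_on z {..<2 * N}"
      and z: "\<And>i. i < 2 * N \<Longrightarrow> z i \<notin> insert b C"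
      and zb: "\<And>i E. i < 2 * N \<Longrightarrow> E \<subseteq> insert b C \<Longrightarrow>
           \<delta> (insert (z i) E) = (if even i then e0 else e1) (insert a E)"
      and zz: "\<And>i j E. i < 2 * N \<Longrightarrow> j < 2 * N \<Longrightarrow> i \<noteq> j \<Longrightarrow> E \<subseteq> C \<Longrightarrow>
           \<delta> (insert (z i) (insert (z j) E)) = max 1 (\<delta> (insert a E))"
      by (rule twin_family[of C a b e0 e1 k "2 * N"])
        (use C e0 e1 jump in \<open>auto simp: joint_type_def\<close>)
    have zC: "\<delta> (insert (z i) E) = \<delta> (insert a E)" if "i < 2 * N" "E \<subseteq> C" for i E
    proof -
      have "insert a E \<subseteq> insert a (insert b C)" "\<not> {a, b} \<subseteq> insert a E" using that C by auto
      then have "e0 (insert a E) = \<delta> (insert a E)" "e1 (insert a E) = \<delta> (insert a E)"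
        using e0 e1 by (simp_all add: joint_type_def)
      moreover have "E \<subseteq> insert b C" using that by blast
      ultimately show ?thesis using zb[of i E] that by simp
    qed
    have "\<exists>h\<in>Stab C. h a = z i \<and> \<pi> h \<xi> \<bullet> v = \<pi> (if even i then g0 else g1) \<xi> \<bullet> v"
      if i: "i < 2 * N" for i
    proof -
      define g where "g = (if even i then g0 else g1)"
      have g: "g \<in> Stab C" "realizes C a b (if even i then e0 else e1) (g a)"
        using g0 g1 by (simp_all add: g_def)
      have same: "\<delta> (insert (g a) E) = \<delta> (insert (z i) E)" if "E \<subseteq> insert b C" for E
        using g(2) zb[OF i that] that by (simp add: realizes_def)
      obtain m where m: "m \<in> Stab (insert b C)" "m (g a) = z i"
        using same_type_conjugate[of "insert b C" "g a" "g a" "z i" "z i"] same C(1) z[OF i] g(2)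
        by (auto simp: realizes_def)
      have mC: "m \<in> Stab C" using m Stab_mono by blast
      have "\<pi> (m \<circ> g) \<xi> \<bullet> v = \<pi> g \<xi> \<bullet> \<pi> (inv m) v"
        using pi_comp pi_adjoint Stab_G g(1) m(1) by metis
      also have "\<pi> (inv m) v = v" using fixed_by_Stab[OF v inv_in_Stab[OF m(1)]] .
      finally have "\<pi> (m \<circ> g) \<xi> \<bullet> v = \<pi> g \<xi> \<bullet> v" .
      moreover have "(m \<circ> g) a = z i" using m(2) by simp
      ultimately show ?thesis unfolding g_def[symmetric] using comp_in_Stab[OF mC g(1)] by blast
    qed
    then obtain h where h: "\<And>i. i < 2 * N \<Longrightarrow> h i \<in> Stab C" "\<And>i. i < 2 * N \<Longrightarrow> h i a = z i"
      "\<And>i. i < 2 * N \<Longrightarrow> \<pi> (h i) \<xi> \<bullet> v = \<pi> (if even i then g0 else g1) \<xi> \<bullet> v"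
      by metis
    define w where "w i = \<pi> (h i) \<xi>" for i
    have gram: "w i \<bullet> w j = w 0 \<bullet> w 1" if ij: "i < 2 * N" "j < 2 * N" "i \<noteq> j" for i j
    proof -
      have N: "0 < 2 * N" "1 < 2 * N" using ij by auto
      have ne: "z i = z j \<longleftrightarrow> z 0 = z 1" using inj_onD[OF inj, of i j] inj_onD[OF inj, of 0 1] ij N by auto
      obtain m where m: "m \<in> Stab C" "m (z i) = z 0" "m (z j) = z 1"
        using same_type_conjugate[of C "z i" "z j" "z 0" "z 1"] C(1) z ij N ne zC zz
        by (metis insertCI zero_neq_one)
      have move: "\<pi> m (w p) = w q" if pq: "p < 2 * N" "q < 2 * N" "m (z p) = z q" for p q
      proof -
        have "\<pi> m (w p) = \<pi> (m \<circ> h p) \<xi>"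
          unfolding w_def by (rule pi_comp[symmetric]) (use Stab_G m(1) h(1)[OF pq(1)] in auto)
        also have "\<dots> = w q"
          unfolding w_def
          by (rule translate_determined[OF \<xi> comp_in_Stab[OF m(1) h(1)[OF pq(1)]] h(1)[OF pq(2)]])
            (simp add: h pq)
        finally show ?thesis .
      qed
      have "\<pi> m (w i) = w 0" "\<pi> m (w j) = w 1" using move ij N m by simp_all
      then show ?thesis using pi_inner[OF Stab_G[OF m(1)], of "w i" "w j"] by simp
    qed
    define u where "u i = w (2 * i) - w (2 * i + 1)" for i
    have nw: "norm (w i) = norm \<xi>" if "i < 2 * N" for i
      unfolding w_def using pi_norm Stab_G h(1)[OF that] by blast
    have "u i \<bullet> v = \<pi> g0 \<xi> \<bullet> v - \<pi> g1 \<xi> \<bullet> v \<and> norm (u i) \<le> 2 * norm \<xi>" if "i < N" for i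
    proof
      show "u i \<bullet> v = \<pi> g0 \<xi> \<bullet> v - \<pi> g1 \<xi> \<bullet> v"
        using h(3)[of "2 * i"] h(3)[of "2 * i + 1"] that by (simp add: u_def w_def inner_diff_left)
      show "norm (u i) \<le> 2 * norm \<xi>"
        using norm_triangle_ineq4[of "w (2 * i)" "w (2 * i + 1)"] nw[of "2 * i"] nw[of "2 * i + 1"] that
        by (simp add: u_def)
    qed
    moreover have "u i \<bullet> u j = 0" if "i < N" "j < N" "i \<noteq> j" for i j
    proof -
      have "2 * i \<noteq> 2 * j" "2 * i \<noteq> 2 * j + 1" "2 * i + 1 \<noteq> 2 * j" "2 * i + 1 \<noteq> 2 * j + 1"
        using that by presburger+
      then show ?thesis
        using that gram[of "2 * i" "2 * j"] gram[of "2 * i" "2 * j + 1"]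
          gram[of "2 * i + 1" "2 * j"] gram[of "2 * i + 1" "2 * j + 1"]
        by (simp add: u_def inner_diff)
    qed
    ultimately show ?thesis by blast
  qed
  from inner_eq_0_if_constant_on_orthogonal_families[OF this] show ?thesis by simp
qed

text \<open>
  The clamped functions lead from \<open>e\<close> to \<open>f\<close> in finitely many steps.  By integrality each step only
  raises some values from \<open>k\<close> to \<open>k + 1\<close>, so it does not change the coefficient.
\<close>

lemma coefficient_eq_le:
  assumes C: "finite C" "a \<notin> C" "b \<notin> C" "a \<noteq> b"
    and e: "joint_type C a b e" and f: "joint_type C a b f"
    and le: "\<And>F. F \<subseteq> insert a (insert b C) \<Longrightarrow> e F \<le> f F"
    and g: "g \<in> Stab C" "realizes C a b e (g a)"
    and h: "h \<in> Stab C" "realizes C a b f (h a)"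
    and \<xi>: "\<xi> \<in> H (insert a C)" and v: "v \<in> H (insert b C)"
  shows "\<pi> g \<xi> \<bullet> v = \<pi> h \<xi> \<bullet> v"
proof -
  let ?Y = "insert a (insert b C)"
  have Y: "F \<in> Fpow ?Y" if "F \<subseteq> ?Y" for F
    using that C(1) finite_subset[OF that] by (simp add: Fpow_def)
  have eY: "integral_diversity_on ?Y e" and fY: "integral_diversity_on ?Y f"
    using e f by (simp_all add: joint_type_def)
  define c where "c k F = max (e F) (min (real k) (f F))" for k :: nat and F
  have c_type: "joint_type C a b (c k)" for k
    using integral_diversity_on_clamp[OF eY fY, of k] e f integral_diversity_onD(2)[OF integral_diversity] Y le
    unfolding joint_type_def c_def by (auto simp: max_def min_def)
  have jump: "c (Suc k) F = c k F \<or> c k F = real k \<and> c (Suc k) F = real k + 1" if F: "F \<subseteq> ?Y" for k F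
  proof -
    obtain m n :: int where "e F = of_int m" "f F = of_int n"
      using integral_diversity_onD(1)[OF eY Y[OF F]] integral_diversity_onD(1)[OF fY Y[OF F]]
      by (auto elim!: Ints_cases)
    moreover have "max m (min (int (Suc k)) n) = max m (min (int k) n) \<or>
        max m (min (int k) n) = int k \<and> max m (min (int (Suc k)) n) = int k + 1" by linarith
    ultimately show ?thesis unfolding c_def
      by (metis (mono_tags, opaque_lifting) of_int_1 of_int_add of_int_max of_int_min of_int_of_nat_eq)
  qed
  have cong: "realizes C a b d' x" if "realizes C a b d x" "\<And>F. F \<subseteq> ?Y \<Longrightarrow> d F = d' F" for d d' x
    using that by (simp add: realizes_def subset_insertI2 insert_mono)
  have step: "\<pi> h' \<xi> \<bullet> v = \<pi> g \<xi> \<bullet> v" if "h' \<in> Stab C" "realizes C a b (c k) (h' a)" for k h'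
    using that
  proof (induction k arbitrary: h')
    case 0
    have "c 0 F = e F" if "F \<subseteq> ?Y" for F
      using integral_diversity_onD(2)[OF eY Y[OF that]] integral_diversity_onD(2)[OF fY Y[OF that]]
      by (simp add: c_def)
    then have "realizes C a b e (h' a)" using cong 0 by blast
    then show ?case using coefficient_eq_twins[OF C e e _ 0(1) _ g \<xi> v] by blast
  next
    case (Suc k)
    obtain g' where g': "g' \<in> Stab C" "realizes C a b (c k) (g' a)"
      using joint_type_realized[OF C c_type] by blast
    have "\<pi> g' \<xi> \<bullet> v = \<pi> h' \<xi> \<bullet> v"
      using coefficient_eq_twins[OF C c_type c_type jump g' Suc.prems \<xi> v] .
    with Suc.IH[OF g'] show ?case by simp
  qed
  define K where "K = nat \<lceil>f ?Y\<rceil>"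
  have "f F = c K F" if "F \<subseteq> ?Y" for F
  proof -
    have "f F \<le> f ?Y" using integral_diversity_onD(5)[OF fY Y that] by simp
    also have "\<dots> \<le> real K" by (simp add: K_def real_nat_ceiling_ge)
    finally show ?thesis using le[OF that] by (simp add: c_def)
  qed
  then have "realizes C a b (c K) (h a)" using cong h(2) by blast
  with step h(1) show ?thesis by simp
qed

text \<open>
  The types of \<open>a\<close> and \<open>g a\<close> over \<open>C \<union> {b}\<close> are \<open>\<delta>\<close> and the pullback of \<open>\<delta>\<close> along the map that sends
  \<open>a\<close> to \<open>g a\<close>.  They need not be comparable, but both lie below their maximum, which is the type of a
  third point of the orbit.
\<close>

proposition coefficient_constant:
  assumes C: "finite C" "a \<notin> C" "b \<notin> C" "a \<noteq> b"
    and g: "g \<in> Stab C" "g a \<noteq> b" and \<xi>: "\<xi> \<in> H (insert a C)" and v: "v \<in> H (insert b C)"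
  shows "\<pi> g \<xi> \<bullet> v = \<xi> \<bullet> v"
proof -
  let ?Y = "insert a (insert b C)"
  define s where "s = id(a := g a)"
  have s: "s ` insert a E = insert (g a) E" "s ` E = E" if "a \<notin> E" for E
    using that by (auto simp: s_def)
  have gaC: "g a \<notin> C" using Stab_notin[OF g(1) C(2)] .
  have "inj_on s ?Y" using gaC g(2) by (auto simp: inj_on_def s_def)
  then have "integral_diversity_on ?Y (\<lambda>F. \<delta> (s ` F))"
    by (rule integral_diversity_on_pullback[OF integral_diversity]) simp
  moreover have "\<delta> (s ` F) = \<delta> F" if F: "F \<subseteq> ?Y" "\<not> {a, b} \<subseteq> F" for F
  proof (cases "a \<in> F")
    case True
    define E where "E = F - {a}"
    have E: "F = insert a E" "a \<notin> E" "E \<subseteq> C" using F True by (auto simp: E_def)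
    have "g ` E = E"
    proof -
      have "g x = x" if "x \<in> E" for x using that E g(1) by (auto simp: pointwise_stabilizer_def)
      then show ?thesis by simp
    qed
    then have "s ` F = g ` F" using s(1)[OF E(2)] E(1) by simp
    moreover have "finite F" using F(1) C(1) finite_subset by blast
    ultimately show ?thesis using Stab_G[OF g(1)] by (simp add: G_iff)
  qed (simp add: s)
  ultimately have ts: "joint_type C a b (\<lambda>F. \<delta> (s ` F))" by (simp add: joint_type_def)
  have td: "joint_type C a b \<delta>" using integral_diversity_on by (simp add: joint_type_def)
  have tm: "joint_type C a b (\<lambda>F. max (\<delta> F) (\<delta> (s ` F)))"
    using integral_diversity_on_max[of ?Y \<delta> "\<lambda>F. \<delta> (s ` F)"] ts td by (simp add: joint_type_def)
  have rs: "realizes C a b (\<lambda>F. \<delta> (s ` F)) (g a)"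
    unfolding realizes_def
  proof (intro conjI allI impI)
    fix E assume "E \<subseteq> insert b C"
    then have "a \<notin> E" using C by auto
    then show "\<delta> (insert (g a) E) = \<delta> (s ` insert a E)" by (subst s(1)) simp_all
  qed (use g(2) gaC in auto)
  have rd: "realizes C a b \<delta> (id a)" using C by (simp add: realizes_def)
  have id: "id \<in> Stab C" using id_in_G by (simp add: pointwise_stabilizer_def)
  obtain h where h: "h \<in> Stab C" "realizes C a b (\<lambda>F. max (\<delta> F) (\<delta> (s ` F))) (h a)"
    using joint_type_realized[OF C tm] by blast
  have "\<pi> g \<xi> \<bullet> v = \<pi> h \<xi> \<bullet> v"
    by (rule coefficient_eq_le[OF C ts tm _ g(1) rs h \<xi> v]) simp
  moreover have "\<pi> id \<xi> \<bullet> v = \<pi> h \<xi> \<bullet> v"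
    by (rule coefficient_eq_le[OF C td tm _ id rd h \<xi> v]) simp
  ultimately show ?thesis by (simp add: pi_id)
qed

section \<open>From one point to finite sets\<close>

text \<open>
  A family of \<open>N\<close> twins of \<open>a\<close> lies in the orbit, for every \<open>N\<close>.
\<close>

lemma infinite_orbit:
  assumes C: "finite C" "a \<notin> C" "b \<notin> C" "a \<noteq> b"
  shows "infinite {g a | g. g \<in> Stab C}"
proof
  let ?O = "{g a | g. g \<in> Stab C}"
  assume fin: "finite ?O"
  define N where "N = Suc (card ?O)"
  obtain z :: "nat \<Rightarrow> 'a" where z: "inj_on z {..<N}" "\<And>i. i < N \<Longrightarrow> z i \<notin> insert b C"
    "\<And>i E. i < N \<Longrightarrow> E \<subseteq> insert b C \<Longrightarrow> \<delta> (insert (z i) E) = (if even i then \<delta> else \<delta>) (insert a E)"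
    by (rule twin_family[of C a b \<delta> \<delta> 0 N]) (use C integral_diversity_on in auto)
  have "z i \<in> ?O" if i: "i < N" for i
  proof -
    have "\<delta> (insert a E) = \<delta> (insert (z i) E)" if "E \<subseteq> C" for E
      using z(3)[OF i, of E] that by (simp add: subset_insertI2)
    then obtain g where "g \<in> Stab C" "g a = z i"
      using same_type_conjugate[of C a a "z i" "z i"] C z(2)[OF i] by auto
    then show ?thesis by (intro CollectI exI[of _ g]) simp
  qed
  then have "card (z ` {..<N}) \<le> card ?O" using fin by (intro card_mono) auto
  moreover have "card (z ` {..<N}) = N" using z(1) by (simp add: card_image)
  ultimately show False by (simp add: N_def)
qed

text \<open>
  The vector \<open>\<zeta>\<close> is the limit of the means of translates of \<open>\<xi>\<close> at distinct points of the orbit of \<open>a\<close>.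
  Constancy of the coefficients with \<open>b\<close> replaced by \<open>a\<close> shows that the inner product of two
  translates at different points is a constant \<open>k\<close>.  So \<open>\<zeta>\<close> and any translate \<open>\<pi> g \<zeta>\<close> have norm squared
  \<open>k\<close> and inner product \<open>k\<close>, that is, they coincide.
\<close>

proposition one_point_dissociation:
  assumes C: "finite C" "a \<notin> C" "b \<notin> C" "a \<noteq> b" and \<xi>: "\<xi> \<in> H (insert a C)"
  obtains \<zeta> where "\<zeta> \<in> H C" "\<And>v. v \<in> H (insert b C) \<Longrightarrow> (\<xi> - \<zeta>) \<bullet> v = 0"
proof -
  \<comment> \<open>The point \<open>b\<close> may lie in the orbit and is avoided, as constancy may fail there.\<close>
  have "infinite ({g a | g. g \<in> Stab C} - {b})" using infinite_orbit[OF C] by simp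
  from infinite_countable_subset[OF this]
  obtain s :: "nat \<Rightarrow> 'a" where s: "inj s" "range s \<subseteq> {g a | g. g \<in> Stab C} - {b}"
    by (elim exE conjE)
  have "\<exists>g. g \<in> Stab C \<and> g a = s n" for n using subsetD[OF s(2) rangeI[of s n]] by auto
  then obtain h where h: "\<And>n. h n \<in> Stab C" "\<And>n. h n a = s n" by metis
  have sb: "s n \<noteq> b" for n using subsetD[OF s(2) rangeI[of s n]] by simp
  have quot: "inv g' \<circ> g \<in> Stab C" "(inv g' \<circ> g) a = a \<longleftrightarrow> g a = g' a"
    "\<pi> g \<xi> \<bullet> \<pi> g' \<xi> = \<pi> (inv g' \<circ> g) \<xi> \<bullet> \<xi>"
    if g: "g \<in> Stab C" "g' \<in> Stab C" for g g'
  proof -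
    have G: "g \<in> G" "g' \<in> G" "bij g'" using g Stab_G G_iff by auto
    show "inv g' \<circ> g \<in> Stab C" using g by (intro comp_in_Stab inv_in_Stab)
    show "(inv g' \<circ> g) a = a \<longleftrightarrow> g a = g' a" using G(3) by (simp add: bij_inv_eq_iff eq_commute)
    have "\<pi> g \<xi> \<bullet> \<pi> g' \<xi> = \<pi> g' \<xi> \<bullet> \<pi> g \<xi>" by (rule inner_commute)
    also have "\<dots> = \<xi> \<bullet> \<pi> (inv g') (\<pi> g \<xi>)" by (rule pi_adjoint[OF G(2)])
    also have "\<dots> = \<pi> (inv g' \<circ> g) \<xi> \<bullet> \<xi>" by (simp only: pi_comp[OF inv_in_G[OF G(2)] G(1)] inner_commute)
    finally show "\<pi> g \<xi> \<bullet> \<pi> g' \<xi> = \<pi> (inv g' \<circ> g) \<xi> \<bullet> \<xi>" .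
  qed
  have moved: "\<pi> r \<xi> \<bullet> \<xi> = \<pi> r' \<xi> \<bullet> \<xi>"
    if r: "r \<in> Stab C" "r' \<in> Stab C" "r a \<noteq> a" "r' a \<noteq> a" for r r'
  proof -
    have G: "r \<in> G" "r' \<in> G" "bij r" using r Stab_G G_iff by auto
    have t: "r' \<circ> inv r \<in> Stab C" using r by (intro comp_in_Stab inv_in_Stab)
    have tr: "(r' \<circ> inv r) (r a) = r' a" "(r' \<circ> inv r) \<circ> r = r'"
      using G(3) by (simp_all add: bij_is_inj fun_eq_iff)
    have "\<pi> r' \<xi> = \<pi> (r' \<circ> inv r) (\<pi> r \<xi>)"
      using pi_comp[OF Stab_G[OF t] G(1), of \<xi>] by (simp only: tr)
    moreover have "\<pi> (r' \<circ> inv r) (\<pi> r \<xi>) \<bullet> \<xi> = \<pi> r \<xi> \<bullet> \<xi>"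
      by (rule coefficient_constant[OF C(1) _ C(2) r(3) t _ translate_in_H[OF \<xi> r(1)] \<xi>])
        (use Stab_notin[OF r(1) C(2)] tr r(4) in simp_all)
    ultimately show ?thesis by simp
  qed
  define w where "w n = \<pi> (h n) \<xi>" for n
  define k where "k = w 0 \<bullet> w 1"
  have s01: "s 0 \<noteq> s 1" using injD[OF s(1), of 0 1] by auto
  have corr: "\<pi> g \<xi> \<bullet> \<pi> g' \<xi> = k" if g: "g \<in> Stab C" "g' \<in> Stab C" "g a \<noteq> g' a" for g g'
    unfolding k_def w_def quot(3)[OF g(1,2)] quot(3)[OF h(1) h(1)]
    by (rule moved)
      (use quot(1,2)[OF g(1,2)] quot(1,2)[OF h(1)[of 0] h(1)[of 1]] g(3) h(2) s01 in simp_all)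
  have nrm: "w n \<bullet> w n = \<xi> \<bullet> \<xi>" for n unfolding w_def using pi_inner Stab_G h(1) by blast
  have off: "w m \<bullet> w n = k" if "m \<noteq> n" for m n
    unfolding w_def by (rule corr) (use h that injD[OF s(1), of m n] in auto)
  obtain \<zeta> where \<zeta>: "\<zeta> \<bullet> \<zeta> = k"
    and weak: "\<And>v t n0. (\<And>n. n \<noteq> n0 \<Longrightarrow> w n \<bullet> v = t) \<Longrightarrow> \<zeta> \<bullet> v = t"
    using equicorrelated_mean_limit[of w, OF nrm off] by metis
  have orbit: "\<zeta> \<bullet> \<pi> g \<xi> = k" if g: "g \<in> Stab C" for g
  proof -
    obtain n0 where "\<And>n. n \<noteq> n0 \<Longrightarrow> s n \<noteq> g a" using s(1) by (metis injD)
    then have "w n \<bullet> \<pi> g \<xi> = k" if "n \<noteq> n0" for n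
      unfolding w_def using that h g by (intro corr) auto
    then show ?thesis by (rule weak)
  qed
  have "\<pi> g \<zeta> = \<zeta>" if g: "g \<in> Stab C" for g
  proof -
    have "w n \<bullet> \<pi> g \<zeta> = k" for n
    proof -
      have "w n \<bullet> \<pi> g \<zeta> = \<pi> g \<zeta> \<bullet> w n" by (rule inner_commute)
      also have "\<dots> = \<zeta> \<bullet> \<pi> (inv g) (w n)" by (rule pi_adjoint[OF Stab_G[OF g]])
      also have "\<pi> (inv g) (w n) = \<pi> (inv g \<circ> h n) \<xi>"
        unfolding w_def by (rule pi_comp[symmetric]) (use inv_in_G Stab_G[OF g] Stab_G[OF h(1)] in simp_all)
      also have "\<zeta> \<bullet> \<dots> = k" by (rule orbit[OF comp_in_Stab[OF inv_in_Stab[OF g] h(1)]])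
      finally show ?thesis .
    qed
    then have "\<zeta> \<bullet> \<pi> g \<zeta> = k" by (rule weak)
    then have "(\<pi> g \<zeta> - \<zeta>) \<bullet> (\<pi> g \<zeta> - \<zeta>) = 0"
      using \<zeta> pi_inner[OF Stab_G[OF g], of \<zeta> \<zeta>] by (simp add: inner_diff inner_commute)
    then show ?thesis by simp
  qed
  then have "\<zeta> \<in> H C" by (simp add: fixed_vectors_def)
  moreover have "(\<xi> - \<zeta>) \<bullet> v = 0" if v: "v \<in> H (insert b C)" for v
  proof -
    have "w n \<bullet> v = \<xi> \<bullet> v" for n
      unfolding w_def by (rule coefficient_constant[OF C h(1) _ \<xi> v]) (simp add: h sb)
    then have "\<zeta> \<bullet> v = \<xi> \<bullet> v" by (rule weak)
    then show ?thesis by (simp add: inner_diff)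
  qed
  ultimately show ?thesis by (rule that)
qed

text \<open>
  Enlarging the set of test vectors from \<open>H (C \<union> D)\<close> by a point \<open>b\<close>, the one-point case over \<open>C \<union> D\<close>
  gives a vector of \<open>H (C \<union> D)\<close>.  It is the projection of \<open>\<xi>\<close> to this space, hence the vector of \<open>H C\<close>
  that is already known.
\<close>

lemma remove_point:
  assumes "finite D" "finite C" "a \<notin> C \<union> D" and \<xi>: "\<xi> \<in> H (insert a C)"
  shows "\<exists>\<zeta>\<in>H C. \<forall>v\<in>H (C \<union> D). (\<xi> - \<zeta>) \<bullet> v = 0"
  using assms(1,3)
proof (induction D rule: finite_induct)
  case empty
  then show ?case using orthogonal_projection_exists[OF subspace_H closed_H] by simp
next
  case (insert b D)
  then obtain \<zeta> where \<zeta>: "\<zeta> \<in> H C" "\<And>v. v \<in> H (C \<union> D) \<Longrightarrow> (\<xi> - \<zeta>) \<bullet> v = 0" by auto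
  show ?case
  proof (cases "b \<in> C")
    case True
    then have "C \<union> insert b D = C \<union> D" by blast
    then show ?thesis using \<zeta> by auto
  next
    case False
    have "\<xi> \<in> H (insert a (C \<union> D))" using \<xi> H_mono[of "insert a C" "insert a (C \<union> D)"] by blast
    moreover have "finite (C \<union> D)" "a \<notin> C \<union> D" "b \<notin> C \<union> D" "a \<noteq> b" using insert assms(2) False by auto
    ultimately obtain \<eta> where \<eta>: "\<eta> \<in> H (C \<union> D)"
      "\<And>v. v \<in> H (insert b (C \<union> D)) \<Longrightarrow> (\<xi> - \<eta>) \<bullet> v = 0"
      using one_point_dissociation by metis
    have d: "\<eta> - \<zeta> \<in> H (C \<union> D)"
      using \<eta>(1) \<zeta>(1) H_mono[of C "C \<union> D"] by (intro subspace_diff[OF subspace_H]) auto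
    then have "\<eta> - \<zeta> \<in> H (insert b (C \<union> D))" using H_mono[of "C \<union> D" "insert b (C \<union> D)"] by blast
    with \<zeta>(2)[OF d] \<eta>(2) have "(\<eta> - \<zeta>) \<bullet> (\<eta> - \<zeta>) = 0" by (simp add: inner_diff_left)
    then have "\<eta> = \<zeta>" by simp
    with \<eta>(2) \<zeta>(1) show ?thesis by auto
  qed
qed

text \<open>
  The points of \<open>F\<close> are dropped one after the other.  To drop \<open>a\<close> while the set \<open>F\<close> remains, the test
  vectors are taken in \<open>H (B \<union> F)\<close>, as the set that is kept has to be contained in the test set.
\<close>

lemma remove_points:
  assumes "finite F" "finite B" "I \<subseteq> B" "F \<inter> B = {}" "\<xi> \<in> H (I \<union> F)"
  shows "\<exists>\<zeta>\<in>H I. \<forall>v\<in>H B. (\<xi> - \<zeta>) \<bullet> v = 0"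
  using assms(1,4,5)
proof (induction F arbitrary: \<xi> rule: finite_induct)
  case empty
  then show ?case by (intro bexI[of _ \<xi>]) simp_all
next
  case (insert a F)
  have "finite (I \<union> F)" "a \<notin> (I \<union> F) \<union> (B \<union> F)" "\<xi> \<in> H (insert a (I \<union> F))" "finite (B \<union> F)"
    using insert assms(2,3) finite_subset by auto
  then obtain \<eta> where \<eta>: "\<eta> \<in> H (I \<union> F)" "\<And>v. v \<in> H (I \<union> F \<union> (B \<union> F)) \<Longrightarrow> (\<xi> - \<eta>) \<bullet> v = 0"
    using remove_point by metis
  obtain \<zeta> where \<zeta>: "\<zeta> \<in> H I" "\<And>v. v \<in> H B \<Longrightarrow> (\<eta> - \<zeta>) \<bullet> v = 0"
    using insert.IH[OF _ \<eta>(1)] insert.prems by auto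
  have "(\<xi> - \<zeta>) \<bullet> v = 0" if "v \<in> H B" for v
  proof -
    have "v \<in> H (I \<union> F \<union> (B \<union> F))" using that H_mono[of B "I \<union> F \<union> (B \<union> F)"] by blast
    from \<eta>(2)[OF this] \<zeta>(2)[OF that] show ?thesis by (simp add: inner_diff_left)
  qed
  with \<zeta>(1) show ?case by blast
qed

theorem dissociated: "dissociated_representation G \<pi>"
  unfolding dissociated_representation_def
proof (intro allI impI ext)
  fix A B :: "'a set" and x :: 'h
  assume "finite A \<and> finite B"
  then have fin: "finite A" "finite (B - A)" by auto
  have proj: "orth_proj (H D) x = y" if "y \<in> H D" "\<And>v. v \<in> H D \<Longrightarrow> (x - y) \<bullet> v = 0" for D x y
    using subspace_H scaleC_H that by (rule orth_proj_eqI)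
  obtain y where y: "y \<in> H B" "\<And>v. v \<in> H B \<Longrightarrow> (x - y) \<bullet> v = 0"
    using orthogonal_projection_exists[OF subspace_H closed_H] by metis
  have "A \<inter> B \<union> (B - A) = B" by blast
  then obtain \<zeta> where \<zeta>: "\<zeta> \<in> H (A \<inter> B)" "\<And>v. v \<in> H A \<Longrightarrow> (y - \<zeta>) \<bullet> v = 0"
    using remove_points[OF fin(2,1), of "A \<inter> B" y] y(1) by auto
  have sub: "H (A \<inter> B) \<subseteq> H A" "H (A \<inter> B) \<subseteq> H B" by (intro H_mono; blast)+
  have "orth_proj (H B) x = y" by (rule proj[OF y])
  moreover have "orth_proj (H A) y = \<zeta>" using \<zeta> sub by (intro proj) auto
  moreover have "orth_proj (H (A \<inter> B)) x = \<zeta>"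
  proof (rule proj[OF \<zeta>(1)])
    fix v assume "v \<in> H (A \<inter> B)"
    then have "(x - y) \<bullet> v = 0" "(y - \<zeta>) \<bullet> v = 0" using y(2) \<zeta>(2) sub by auto
    then show "(x - \<zeta>) \<bullet> v = 0" by (simp add: inner_diff_left)
  qed
  ultimately show "(orth_proj (H A) \<circ> orth_proj (H B)) x = orth_proj (H (A \<inter> B)) x" by simp
qed

end

theorem theorem5p23:
  fixes \<delta> :: "'a set \<Rightarrow> real"
  assumes "integral_Fraisse_limit \<delta>"
  shows "dissociated_group TYPE('h::complex_hilbert_space) (diversity_Aut \<delta>)"
  unfolding dissociated_group_def
proof (intro allI impI)
  fix \<pi> :: "('a \<Rightarrow> 'a) \<Rightarrow> 'h \<Rightarrow> 'h"
  assume "unitary_representation (diversity_Aut \<delta>) \<pi>"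
  with assms interpret limit_representation \<delta> \<pi> by unfold_locales
  show "dissociated_representation (diversity_Aut \<delta>) \<pi>" by (rule dissociated)
qed

end
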